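(* Let $X$ be a rigid $\mathcal{B}$-group and let $R := R(X) = \bigoplus_{\rho \in T_{cr}(X)} R_\rho$ be the homogeneous decomposition of its regulator. Then $X$ has a description $X = R + \frac{\mathbb{Z}}{e} \sum_{\rho \in T_{cr}(X)} \alpha_\rho v_\rho$ where (1) $\{v_\rho \mid \rho \in T_{cr}(R)\}$ is a decomposition basis of $R$, so $R = \bigoplus_{\rho \in T_{cr}(X)} \rho v_\rho$; (2) for all $\tau \in T_{cr}(X)$, $\gcd^R\bigl(e,\sum_{\rho \neq \tau} \alpha_\rho v_\rho\bigr) = 1$; (3) $e = [X : R]$; (4) each $\alpha_\rho$ is an integral factor of $e$; and (5) for all $\tau \in T_{cr}(X)$, $\mu_\tau(X) = \frac{e}{\alpha_\tau}$. If $\operatorname{rk}(X) = 2$ and $[X:R]=e$, then there is a decomposition basis $\{v_1,v_2\}$ of $R = \tau_1 v_1 \oplus \tau_2 v_2$ such that $X = R + \mathbb{Z} e^{-1}(v_1 + v_2)$ with $\gcd^R(e,v_i) = 1$ for $i=1,2$.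
   Context: All groups are torsion-free abelian of finite rank. Types are isomorphism classes of rank-one groups, with $\sigma\le\tau$ iff there is a nonzero homomorphism from a group of type $\sigma$ to one of type $\tau$. A completely decomposable group is a direct sum of rank-one groups; its homogeneous decomposition is $A=\bigoplus_{\rho\in T_{cr}(A)}A_\rho$, where $A_\rho\neq 0$ is a direct sum of rank-one groups of type $\rho$, and $T_{cr}(A)$ is the critical typeset of $A$. An almost completely decomposable group is a group $X$ containing a completely decomposable subgroup of finite index; the completely decomposable subgroups of least index in $X$ are its regulating subgroups, and the regulator $R(X)$ is the intersection of all of them (it is completely decomposable, fully invariant, of finite index in $X$). Put $T_{cr}(X)=T_{cr}(R(X))$. $X$ is block-rigid if $T_{cr}(X)$ is an antichain, and rigid if moreover every $\operatorname{rk}(R(X)_\rho)=1$. $\mathcal{B}$ is the class of block-rigid almost completely decomposable groups $X$ with $X/R(X)$ cyclic; its members are called $\mathcal{B}$-groups. A rational group is an additive subgroup of $\mathbb{Q}$ containing $1$. A completely decomposable group of rank $r$ can be written $A=\bigoplus_{i=1}^r \tau_i v_i$ where the $\tau_iv_i$ are rank-one summands, $0\ne v_i$ lies in that summand, and $\tau_i=\{x\in\mathbb{Q}\mid xv_i\in A\}$ is a rational group; then $\{v_1,\dots,v_r\}$ is called a decomposition basis of $A$. The same symbol is used for a rational group and its type. For a positive integer $e$ and $a\in A$, $\gcd^A(e,a)=d$ where $m=\operatorname{ord}(a+eA)$ in $A/eA$ and $e=md$. Invariants: for a $\mathcal{B}$-group $X$ with regulator $R$, write $X=R+\mathbb{Z}e^{-1}a$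 with $e$ a positive integer such that $eX\subseteq R$ and $a=\sum_{\rho\in T_{cr}(X)} a_\rho\in R$, $a_\rho\in R_\rho$; then $\mu_\tau(X)=\operatorname{ord}(a_\tau+eR)$ (with $a_\tau=0$ if $\tau\notin T_{cr}(X)$), which is independent of the choices of $e$ and $a$. *)

theory Defs
  imports Complex_Main "HOL-Algebra.Elementary_Groups" "HOL-Algebra.Multiplicative_Group"
begin

text \<open>
  Abelian groups are commutative groups of HOL-Algebra and hence written multiplicatively: the
  informal \<open>x + y\<close>, \<open>n x\<close>, \<open>0\<close> and \<open>\<Sum>\<close> are \<open>x \<otimes> y\<close>, \<open>x [^] n\<close>, \<open>\<one>\<close> and \<open>\<Otimes>\<close>. Notions for a
  group \<open>A\<close> that occurs as a subgroup take an ambient group \<open>G\<close> and the subset \<open>A\<close> of its carrier.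
\<close>

section \<open>Torsion-free groups of finite rank\<close>

definition torsion_free :: "('a, 'b) monoid_scheme \<Rightarrow> bool" where
  "torsion_free G \<longleftrightarrow>
     (\<forall>x\<in>carrier G. \<forall>n::nat. 0 < n \<longrightarrow> x [^]\<^bsub>G\<^esub> n = \<one>\<^bsub>G\<^esub> \<longrightarrow> x = \<one>\<^bsub>G\<^esub>)"

definition Z_independent :: "('a, 'b) monoid_scheme \<Rightarrow> 'a set \<Rightarrow> bool" where
  "Z_independent G B \<longleftrightarrow> finite B \<and> B \<subseteq> carrier G \<and>
     (\<forall>c :: 'a \<Rightarrow> int. (\<Otimes>\<^bsub>G\<^esub>b\<in>B. b [^]\<^bsub>G\<^esub> c b) = \<one>\<^bsub>G\<^esub> \<longrightarrow> (\<forall>b\<in>B. c b = 0))"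

definition finite_rank :: "('a, 'b) monoid_scheme \<Rightarrow> bool" where
  "finite_rank G \<longleftrightarrow> (\<exists>n. \<forall>B. Z_independent G B \<longrightarrow> card B \<le> n)"

definition rk :: "('a, 'b) monoid_scheme \<Rightarrow> 'a set \<Rightarrow> nat" where
  "rk G A = Sup {card B | B. B \<subseteq> A \<and> Z_independent G B}"

definition tffr_group :: "('a, 'b) monoid_scheme \<Rightarrow> bool" where
  "tffr_group G \<longleftrightarrow> comm_group G \<and> torsion_free G \<and> finite_rank G"

section \<open>Rational groups and types\<close>

definition rat_group :: "rat set \<Rightarrow> rat monoid" where
  "rat_group S = \<lparr>carrier = S, monoid.mult = (+), one = 0\<rparr>"

definition rational_group :: "rat set \<Rightarrow> bool" where
  "rational_group S \<longleftrightarrow> subgroup S (rat_group UNIV) \<and> 1 \<in> S"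

text \<open>
  Every torsion-free group of rank one is isomorphic to a rational group, so an isomorphism class
  of rank-one groups is represented by the set of all rational groups belonging to it.
\<close>

type_synonym rtype = "rat set set"

definition type_of :: "('a, 'b) monoid_scheme \<Rightarrow> 'a set \<Rightarrow> rtype" where
  "type_of G A = {S. rational_group S \<and> rat_group S \<cong> G\<lparr>carrier := A\<rparr>}"

definition type_le :: "rtype \<Rightarrow> rtype \<Rightarrow> bool" where
  "type_le \<sigma> \<tau> \<longleftrightarrow>
     (\<exists>S\<in>\<sigma>. \<exists>T\<in>\<tau>. \<exists>h\<in>hom (rat_group S) (rat_group T). \<exists>x\<in>S. h x \<noteq> 0)"

section \<open>Completely decomposable groups\<close>

text \<open>\<open>A\<close> is the internal direct sum of the finite family \<open>F\<close> of subgroups of \<open>G\<close>.\<close>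

definition direct_decomp ::
  "('a, 'b) monoid_scheme \<Rightarrow> 'a set \<Rightarrow> 'i set \<Rightarrow> ('i \<Rightarrow> 'a set) \<Rightarrow> bool" where
  "direct_decomp G A I F \<longleftrightarrow> finite I \<and> (\<forall>i\<in>I. subgroup (F i) G) \<and>
     bij_betw (\<lambda>f. \<Otimes>\<^bsub>G\<^esub>i\<in>I. f i) (\<Pi>\<^sub>E i\<in>I. F i) A"

definition completely_decomposable :: "('a, 'b) monoid_scheme \<Rightarrow> 'a set \<Rightarrow> bool" where
  "completely_decomposable G A \<longleftrightarrow>
     (\<exists>(n::nat) F. direct_decomp G A {..<n} F \<and> (\<forall>i<n. rk G (F i) = 1))"

definition homogeneous :: "('a, 'b) monoid_scheme \<Rightarrow> rtype \<Rightarrow> 'a set \<Rightarrow> bool" where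
  "homogeneous G \<rho> A \<longleftrightarrow>
     (\<exists>(n::nat) F. direct_decomp G A {..<n} F \<and>
        (\<forall>i<n. rk G (F i) = 1 \<and> type_of G (F i) = \<rho>))"

definition homogeneous_decomposition ::
  "('a, 'b) monoid_scheme \<Rightarrow> 'a set \<Rightarrow> rtype set \<Rightarrow> (rtype \<Rightarrow> 'a set) \<Rightarrow> bool" where
  "homogeneous_decomposition G A T F \<longleftrightarrow> direct_decomp G A T F \<and>
     (\<forall>\<rho>\<in>T. F \<rho> \<noteq> {\<one>\<^bsub>G\<^esub>} \<and> homogeneous G \<rho> (F \<rho>))"

text \<open>The index set of a homogeneous decomposition is uniquely determined by the group.\<close>

definition critical_typeset :: "('a, 'b) monoid_scheme \<Rightarrow> 'a set \<Rightarrow> rtype set" where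
  "critical_typeset G A = {\<rho>. \<exists>T F. homogeneous_decomposition G A T F \<and> \<rho> \<in> T}"

text \<open>
  In a torsion-free group \<open>G\<close> there is at most one \<open>y\<close> with \<open>y = q v\<close>; as a subgroup of its
  divisible hull, \<open>G\<close> contains \<open>q v\<close> iff such a \<open>y\<close> exists.
\<close>

definition is_rat_multiple :: "('a, 'b) monoid_scheme \<Rightarrow> rat \<Rightarrow> 'a \<Rightarrow> 'a \<Rightarrow> bool" where
  "is_rat_multiple G q v y \<longleftrightarrow>
     (\<exists>m n :: int. 0 < n \<and> q = of_int m / of_int n \<and> y [^]\<^bsub>G\<^esub> n = v [^]\<^bsub>G\<^esub> m)"

text \<open>The rational group \<open>{x \<in> \<rat> | x v \<in> A}\<close>, and the group \<open>S v\<close> for a set \<open>S\<close> of rationals.\<close>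

definition coeff_group :: "('a, 'b) monoid_scheme \<Rightarrow> 'a set \<Rightarrow> 'a \<Rightarrow> rat set" where
  "coeff_group G A v = {q. \<exists>y\<in>A. is_rat_multiple G q v y}"

definition rat_multiples :: "('a, 'b) monoid_scheme \<Rightarrow> rat set \<Rightarrow> 'a \<Rightarrow> 'a set" where
  "rat_multiples G S v = {y \<in> carrier G. \<exists>q\<in>S. is_rat_multiple G q v y}"

definition decomposition_basis :: "('a, 'b) monoid_scheme \<Rightarrow> 'a set \<Rightarrow> 'a set \<Rightarrow> bool" where
  "decomposition_basis G A V \<longleftrightarrow> V \<subseteq> A - {\<one>\<^bsub>G\<^esub>} \<and>
     direct_decomp G A V (\<lambda>v. rat_multiples G (coeff_group G A v) v) \<and>
     (\<forall>v\<in>V. rk G (rat_multiples G (coeff_group G A v) v) = 1)"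

section \<open>Almost completely decomposable groups\<close>

definition finite_index_cd :: "('a, 'b) monoid_scheme \<Rightarrow> 'a set \<Rightarrow> bool" where
  "finite_index_cd X W \<longleftrightarrow>
     subgroup W X \<and> completely_decomposable X W \<and> finite (rcosets\<^bsub>X\<^esub> W)"

definition almost_completely_decomposable :: "('a, 'b) monoid_scheme \<Rightarrow> bool" where
  "almost_completely_decomposable X \<longleftrightarrow> tffr_group X \<and> (\<exists>W. finite_index_cd X W)"

definition regulating :: "('a, 'b) monoid_scheme \<Rightarrow> 'a set \<Rightarrow> bool" where
  "regulating X W \<longleftrightarrow> finite_index_cd X W \<and>
     (\<forall>W'. finite_index_cd X W' \<longrightarrow> card (rcosets\<^bsub>X\<^esub> W) \<le> card (rcosets\<^bsub>X\<^esub> W'))"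

definition regulator :: "('a, 'b) monoid_scheme \<Rightarrow> 'a set" where
  "regulator X = \<Inter>{W. regulating X W}"

definition Tcr :: "('a, 'b) monoid_scheme \<Rightarrow> rtype set" where
  "Tcr X = critical_typeset X (regulator X)"

definition block_rigid :: "('a, 'b) monoid_scheme \<Rightarrow> bool" where
  "block_rigid X \<longleftrightarrow> (\<forall>\<sigma>\<in>Tcr X. \<forall>\<tau>\<in>Tcr X. type_le \<sigma> \<tau> \<longrightarrow> \<sigma> = \<tau>)"

definition rigid :: "('a, 'b) monoid_scheme \<Rightarrow> bool" where
  "rigid X \<longleftrightarrow> block_rigid X \<and>
     (\<forall>F. homogeneous_decomposition X (regulator X) (Tcr X) F \<longrightarrow> (\<forall>\<rho>\<in>Tcr X. rk X (F \<rho>) = 1))"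

definition B_group :: "('a, 'b) monoid_scheme \<Rightarrow> bool" where
  "B_group X \<longleftrightarrow>
     almost_completely_decomposable X \<and> block_rigid X \<and> cyclic_group (X Mod regulator X)"

section \<open>Invariants\<close>

text \<open>\<open>ord_mod G A e a\<close> is the order of \<open>a + eA\<close> in \<open>A/eA\<close>; it divides \<open>e\<close>.\<close>

definition ord_mod :: "('a, 'b) monoid_scheme \<Rightarrow> 'a set \<Rightarrow> nat \<Rightarrow> 'a \<Rightarrow> nat" where
  "ord_mod G A e a =
     (let eA = (\<lambda>x. x [^]\<^bsub>G\<^esub> e) ` A
      in group.ord (G\<lparr>carrier := A\<rparr> Mod eA) (eA #>\<^bsub>G\<^esub> a))"

definition gcd_in :: "('a, 'b) monoid_scheme \<Rightarrow> 'a set \<Rightarrow> nat \<Rightarrow> 'a \<Rightarrow> nat" where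
  "gcd_in G A e a = e div ord_mod G A e a"

text \<open>\<open>X = R + \<int>e\<^sup>-\<^sup>1a\<close>, where \<open>e\<^sup>-\<^sup>1a\<close> is the unique \<open>x\<close> with \<open>e x = a\<close>.\<close>

definition described_by :: "('a, 'b) monoid_scheme \<Rightarrow> 'a set \<Rightarrow> nat \<Rightarrow> 'a \<Rightarrow> bool" where
  "described_by X R e a \<longleftrightarrow> 0 < e \<and>
     (\<exists>x\<in>carrier X. x [^]\<^bsub>X\<^esub> e = a \<and>
        carrier X = R <#>\<^bsub>X\<^esub> range (\<lambda>k::int. x [^]\<^bsub>X\<^esub> k))"

definition mu :: "('a, 'b) monoid_scheme \<Rightarrow> rtype \<Rightarrow> nat" where
  "mu X \<tau> = (THE m. \<exists>e F a.
     homogeneous_decomposition X (regulator X) (Tcr X) F \<and>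
     (\<forall>x\<in>carrier X. x [^]\<^bsub>X\<^esub> e \<in> regulator X) \<and>
     a \<in> (\<Pi> \<rho>\<in>Tcr X. F \<rho>) \<and>
     described_by X (regulator X) e (\<Otimes>\<^bsub>X\<^esub>\<rho>\<in>Tcr X. a \<rho>) \<and>
     m = ord_mod X (regulator X) e (if \<tau> \<in> Tcr X then a \<tau> else \<one>\<^bsub>X\<^esub>))"

end

theory Submission
  imports Defs
begin

text \<open>
  Write \<open>X = R + \<int>x\<close> and \<open>e x = \<Sum> a\<^sub>\<rho>\<close> with \<open>a\<^sub>\<rho> \<in> R\<^sub>\<rho>\<close>. Let \<open>J\<close> be a set of types with complement
  \<open>J'\<close>, and let \<open>P\<close> be the purification of \<open>\<Sum>\<^bsub>\<rho> \<in> J'\<^esub> R\<^sub>\<rho>\<close> in \<open>X\<close>. Then \<open>k \<Sum>\<^bsub>\<rho> \<in> J\<^esub> a\<^sub>\<rho>\<close> lies in \<open>eR\<close>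
  iff \<open>k x\<close> lies in \<open>R + P\<close>, so the order of \<open>\<Sum>\<^bsub>\<rho> \<in> J\<^esub> a\<^sub>\<rho>\<close> modulo \<open>eR\<close> is the index \<open>[X : R + P]\<close>.
  For \<open>J = {\<tau>}\<close> this shows that \<open>\<mu>\<^sub>\<tau>\<close> is well defined; for \<open>J' = {\<tau>}\<close> it gives (2), once \<open>R\<^sub>\<tau>\<close> is
  known to be pure in \<open>X\<close>.

  Purifying all summands of a regulating subgroup \<open>W\<close> yields a completely decomposable group that
  contains \<open>W\<close> and hence equals \<open>W\<close>, so these summands are pure in \<open>X\<close>. As the types form an
  antichain, every homomorphism \<open>R\<^sub>\<tau> \<rightarrow> X\<close> maps into the purification of \<open>R\<^sub>\<tau>\<close>; applied to the
  projections of \<open>W\<close>, this puts each element of \<open>R\<^sub>\<tau>\<close> into a single summand of \<open>W\<close>. So the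
  purification of \<open>R\<^sub>\<tau>\<close> is contained in every \<open>W\<close>, hence in \<open>R\<close>.

  The basis consists of the \<open>v\<^sub>\<rho> \<in> R\<^sub>\<rho>\<close> with \<open>a\<^sub>\<rho> = \<alpha>\<^sub>\<rho> v\<^sub>\<rho>\<close> for \<open>\<alpha>\<^sub>\<rho> = gcd(e, a\<^sub>\<rho>)\<close>; if \<open>a\<^sub>\<rho> = 0\<close>, it
  is first replaced by \<open>e v\<^sub>\<rho>\<close> with any nonzero \<open>v\<^sub>\<rho>\<close>. In rank two, (2) forces both \<open>\<alpha>\<^sub>\<rho>\<close> to be \<open>1\<close>.
\<close>

section \<open>Torsion-free abelian groups\<close>

lemma (in comm_group) finprod_int_pow:
  assumes "f \<in> I \<rightarrow> carrier G"
  shows "(\<Otimes>i\<in>I. f i [^] (n::int)) = (\<Otimes>i\<in>I. f i) [^] n"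
  using assms
proof (induction I rule: infinite_finite_induct)
  case (insert i I)
  then show ?case by (simp add: int_pow_distrib Pi_iff)
qed auto

lemma (in group) subgroup_nat_pow_closed:
  assumes "subgroup H G" "x \<in> H" shows "x [^] (n::nat) \<in> H"
  using subgroup_int_pow_closed[OF assms, of "int n"] by (simp add: int_pow_int)

locale torsion_free_group = comm_group G for G (structure) +
  assumes torsion_free: "torsion_free G"
begin

lemma int_pow_eq_one_iff:
  assumes "x \<in> carrier G"
  shows "x [^] (n::int) = \<one> \<longleftrightarrow> n = 0 \<or> x = \<one>"
proof -
  have pos: "x = \<one>" if "0 < k" "x [^] (k::int) = \<one>" for k
  proof -
    have "x [^] nat k = \<one>" using that int_pow_int[of G x "nat k"] by simp
    then show ?thesis using torsion_free assms that(1) unfolding torsion_free_def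
      by (metis zero_less_nat_eq)
  qed
  have "x = \<one>" if "n \<noteq> 0" "x [^] n = \<one>"
    using pos[of n] pos[of "-n"] that assms by (cases "0 < n") (auto simp: int_pow_neg)
  then show ?thesis by auto
qed

lemma int_pow_cancel:
  assumes "x \<in> carrier G" "y \<in> carrier G" "x [^] (n::int) = y [^] n" "n \<noteq> 0"
  shows "x = y"
proof -
  have "(x \<otimes> inv y) [^] n = \<one>"
    using assms by (simp add: int_pow_distrib int_pow_inv)
  then have "x \<otimes> inv y = \<one>" using assms int_pow_eq_one_iff[of "x \<otimes> inv y" n] by auto
  then show ?thesis using assms by (metis inv_closed inv_equality inv_inv)
qed

lemma nat_pow_cancel:
  assumes "x \<in> carrier G" "y \<in> carrier G" "x [^] (n::nat) = y [^] n" "0 < n"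
  shows "x = y"
  using int_pow_cancel[of x y "int n"] assms by (simp add: int_pow_int)

end

section \<open>Purifications\<close>

context comm_group
begin

definition purification :: "'a set \<Rightarrow> 'a set" where
  "purification H = {x \<in> carrier G. \<exists>k::int. k \<noteq> 0 \<and> x [^] k \<in> H}"

lemma purificationI: "x \<in> carrier G \<Longrightarrow> x [^] (k::int) \<in> H \<Longrightarrow> k \<noteq> 0 \<Longrightarrow> x \<in> purification H"
  unfolding purification_def by blast

lemma purification_natI:
  "x \<in> carrier G \<Longrightarrow> x [^] (n::nat) \<in> H \<Longrightarrow> 0 < n \<Longrightarrow> x \<in> purification H"
  using purificationI[of x "int n"] by (simp add: int_pow_int)

lemma purificationE:
  assumes "x \<in> purification H"
  obtains k :: int where "x \<in> carrier G" "k \<noteq> 0" "x [^] k \<in> H"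
  using assms unfolding purification_def by blast

lemma subset_purification: "H \<subseteq> carrier G \<Longrightarrow> H \<subseteq> purification H"
  using purificationI[of _ 1] by auto

lemma purification_subset_carrier: "purification H \<subseteq> carrier G"
  unfolding purification_def by blast

lemma common_exponent:
  assumes "finite I" and H: "\<And>i. i \<in> I \<Longrightarrow> subgroup (H i) G"
    and f: "\<And>i. i \<in> I \<Longrightarrow> f i \<in> purification (H i)"
  shows "\<exists>k::int. k \<noteq> 0 \<and> (\<forall>i\<in>I. f i [^] k \<in> H i)"
  using assms
proof (induction I rule: finite_induct)
  case (insert j I)
  then obtain k :: int where k: "k \<noteq> 0" "\<And>i. i \<in> I \<Longrightarrow> f i [^] k \<in> H i" by auto
  obtain l :: int where l: "l \<noteq> 0" "f j [^] l \<in> H j"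
    using insert.prems(2)[of j] by (auto elim: purificationE)
  have pow: "f i [^] (m * n) \<in> H i" if "i \<in> insert j I" "f i [^] m \<in> H i" for i and m n :: int
  proof -
    have "f i \<in> carrier G"
      using insert.prems(2)[OF that(1)] purification_subset_carrier by blast
    then show ?thesis
      using subgroup_int_pow_closed[OF insert.prems(1)[OF that(1)] that(2), of n]
      by (simp add: int_pow_pow)
  qed
  have "f i [^] (k * l) \<in> H i" if "i \<in> insert j I" for i
    using pow[OF that, of k l] pow[OF that, of l k] that k(2) l(2) by (auto simp: mult.commute)
  then show ?case using k(1) l(1) by (intro exI[of _ "k * l"]) auto
qed (auto intro: exI[of _ "1::int"])

lemma purification_subgroup:
  assumes H: "subgroup H G"
  shows "subgroup (purification H) G"
proof (rule subgroupI)
  show "purification H \<noteq> {}"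
    using subset_purification[OF subgroup.subset[OF H]] subgroup.one_closed[OF H] by blast
  show "inv x \<in> purification H" if "x \<in> purification H" for x
    using that subgroup.m_inv_closed[OF H]
    by (auto elim!: purificationE intro!: purificationI simp: int_pow_inv)
  show "x \<otimes> y \<in> purification H" if xy: "x \<in> purification H" "y \<in> purification H" for x y
  proof -
    obtain k :: int where k: "k \<noteq> 0" "\<forall>z\<in>{x, y}. z [^] k \<in> H"
      using common_exponent[of "{x, y}" "\<lambda>_. H" "\<lambda>z. z"] H xy by auto
    have "(x \<otimes> y) [^] k \<in> H"
      using k(2) xy purification_subset_carrier subgroup.m_closed[OF H]
      by (auto simp: int_pow_distrib subset_iff)
    then show ?thesis using k(1) xy purification_subset_carrier by (blast intro: purificationI)
  qed
qed (rule purification_subset_carrier)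

end

section \<open>Internal direct sums\<close>

lemma (in comm_group) direct_decompI:
  assumes "finite I" and F: "\<And>i. i \<in> I \<Longrightarrow> subgroup (F i) G"
    and in_A: "\<And>f. f \<in> Pi I F \<Longrightarrow> (\<Otimes>i\<in>I. f i) \<in> A"
    and onto: "\<And>y. y \<in> A \<Longrightarrow> \<exists>f\<in>Pi I F. y = (\<Otimes>i\<in>I. f i)"
    and independent: "\<And>f i. f \<in> Pi I F \<Longrightarrow> (\<Otimes>i\<in>I. f i) = \<one> \<Longrightarrow> i \<in> I \<Longrightarrow> f i = \<one>"
  shows "direct_decomp G A I F"
  unfolding direct_decomp_def bij_betw_def
proof (intro conjI ballI inj_onI subset_antisym subsetI)
  have Fc: "f \<in> I \<rightarrow> carrier G" if "f \<in> Pi I F" for f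
    using that F subgroup.mem_carrier by fast
  fix f g assume f: "f \<in> (\<Pi>\<^sub>E i\<in>I. F i)" and g: "g \<in> (\<Pi>\<^sub>E i\<in>I. F i)"
    and eq: "(\<Otimes>i\<in>I. f i) = (\<Otimes>i\<in>I. g i)"
  have fc: "f \<in> I \<rightarrow> carrier G" and gc: "g \<in> I \<rightarrow> carrier G"
    using f g Fc by (auto simp: PiE_iff)
  let ?h = "\<lambda>i. f i \<otimes> inv g i"
  have h: "?h \<in> Pi I F"
    using f g F subgroup.m_closed subgroup.m_inv_closed by (fastforce simp: PiE_iff)
  have "(\<Otimes>i\<in>I. inv g i) = inv (\<Otimes>i\<in>I. g i)"
    using finprod_int_pow[OF gc, of "- 1"] gc by (simp add: int_pow_neg Pi_iff cong: finprod_cong)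
  then have "(\<Otimes>i\<in>I. ?h i) = \<one>"
    using eq fc gc by (subst finprod_multf) (auto simp: Pi_iff)
  then have "f i \<otimes> inv g i = \<one>" if "i \<in> I" for i using independent[OF h _ that] by blast
  then have "f i = g i" if "i \<in> I" for i
    using that fc gc by (metis PiE inv_closed inv_equality inv_inv)
  then show "f = g" using PiE_ext[OF f g] by blast
next
  show "y \<in> A" if "y \<in> (\<lambda>f. \<Otimes>i\<in>I. f i) ` (\<Pi>\<^sub>E i\<in>I. F i)" for y
    using that in_A by (auto simp: PiE_iff)
  show "y \<in> (\<lambda>f. \<Otimes>i\<in>I. f i) ` (\<Pi>\<^sub>E i\<in>I. F i)" if y: "y \<in> A" for y
  proof -
    obtain f where f: "f \<in> Pi I F" "y = (\<Otimes>i\<in>I. f i)" using onto[OF y] by blast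
    have "(\<Otimes>i\<in>I. restrict f I i) = (\<Otimes>i\<in>I. f i)"
      using f(1) F subgroup.mem_carrier by (intro finprod_cong') fastforce+
    then show ?thesis using f by (intro image_eqI[of _ _ "restrict f I"]) auto
  qed
qed (use assms in auto)

locale direct_sum = comm_group G for G (structure) +
  fixes A :: "'a set" and I :: "'i set" and F :: "'i \<Rightarrow> 'a set"
  assumes decomp: "direct_decomp G A I F"
begin

definition component :: "'i \<Rightarrow> 'a \<Rightarrow> 'a" where
  "component i y = inv_into (\<Pi>\<^sub>E i\<in>I. F i) (\<lambda>f. \<Otimes>i\<in>I. f i) y i"

lemma finite_index: "finite I"
  and summand_subgroup: "i \<in> I \<Longrightarrow> subgroup (F i) G"
  and finprod_bij: "bij_betw (\<lambda>f. \<Otimes>i\<in>I. f i) (\<Pi>\<^sub>E i\<in>I. F i) A"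
  using decomp unfolding direct_decomp_def by auto

lemma summand_carrier: "i \<in> I \<Longrightarrow> F i \<subseteq> carrier G"
  using summand_subgroup subgroup.subset by blast

lemma family_carrier: "J \<subseteq> I \<Longrightarrow> f \<in> Pi J F \<Longrightarrow> f \<in> J \<rightarrow> carrier G"
  using summand_carrier by blast

lemma component_in: "y \<in> A \<Longrightarrow> i \<in> I \<Longrightarrow> component i y \<in> F i"
  unfolding component_def using finprod_bij inv_into_into[of y "\<lambda>f. \<Otimes>i\<in>I. f i" "\<Pi>\<^sub>E i\<in>I. F i"]
  by (auto simp: bij_betw_def)

lemma component_carrier: "y \<in> A \<Longrightarrow> i \<in> I \<Longrightarrow> component i y \<in> carrier G"
  using component_in summand_carrier by blast

lemma finprod_component: "y \<in> A \<Longrightarrow> (\<Otimes>i\<in>I. component i y) = y"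
  unfolding component_def using finprod_bij f_inv_into_f[of y "\<lambda>f. \<Otimes>i\<in>I. f i" "\<Pi>\<^sub>E i\<in>I. F i"]
  by (auto simp: bij_betw_def)

lemma in_carrier: "y \<in> A \<Longrightarrow> y \<in> carrier G"
  by (metis finprod_component finprod_closed component_carrier Pi_I)

lemma finprod_restrict:
  assumes "f \<in> Pi I F" shows "(\<Otimes>i\<in>I. restrict f I i) = (\<Otimes>i\<in>I. f i)"
  using family_carrier[OF subset_refl assms] by (intro finprod_cong') auto

lemma finprod_in:
  assumes "f \<in> Pi I F" shows "(\<Otimes>i\<in>I. f i) \<in> A"
proof -
  have "restrict f I \<in> (\<Pi>\<^sub>E i\<in>I. F i)" using assms by auto
  then have "(\<Otimes>i\<in>I. restrict f I i) \<in> A" by (rule bspec[OF bij_betwE[OF finprod_bij]])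
  then show ?thesis using finprod_restrict[OF assms] by simp
qed

lemma component_finprod:
  assumes "f \<in> Pi I F" "i \<in> I" shows "component i (\<Otimes>i\<in>I. f i) = f i"
proof -
  have "restrict f I \<in> (\<Pi>\<^sub>E i\<in>I. F i)" using assms by auto
  then have "inv_into (\<Pi>\<^sub>E i\<in>I. F i) (\<lambda>f. \<Otimes>i\<in>I. f i) (\<Otimes>i\<in>I. restrict f I i) = restrict f I"
    using finprod_bij by (intro inv_into_f_f) (auto simp: bij_betw_def)
  then show ?thesis unfolding component_def finprod_restrict[OF assms(1)]
    using assms(2) by simp
qed

lemma component_eqI:
  assumes "y \<in> A" "z \<in> A" "\<And>i. i \<in> I \<Longrightarrow> component i y = component i z"
  shows "y = z"
proof -
  have "(\<Otimes>i\<in>I. component i y) = (\<Otimes>i\<in>I. component i z)"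
    using assms component_carrier by (intro finprod_cong') auto
  then show ?thesis using assms finprod_component by simp
qed

lemma
  assumes "y \<in> A" "z \<in> A"
  shows mult_in: "y \<otimes> z \<in> A"
    and component_mult: "i \<in> I \<Longrightarrow> component i (y \<otimes> z) = component i y \<otimes> component i z"
proof -
  let ?f = "\<lambda>i. component i y \<otimes> component i z"
  have f: "?f \<in> Pi I F"
    using component_in assms summand_subgroup subgroup.m_closed by (metis (no_types, lifting) Pi_I)
  have "(\<Otimes>i\<in>I. ?f i) = (\<Otimes>i\<in>I. component i y) \<otimes> (\<Otimes>i\<in>I. component i z)"
    using assms component_carrier by (intro finprod_multf) auto
  then have eq: "(\<Otimes>i\<in>I. ?f i) = y \<otimes> z" using finprod_component assms by simp
  show "y \<otimes> z \<in> A" using finprod_in[OF f] eq by simp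
  show "i \<in> I \<Longrightarrow> component i (y \<otimes> z) = component i y \<otimes> component i z"
    using component_finprod[OF f] eq by simp
qed

lemma
  assumes "y \<in> A"
  shows int_pow_in: "y [^] (n::int) \<in> A"
    and component_int_pow: "i \<in> I \<Longrightarrow> component i (y [^] n) = component i y [^] n"
proof -
  let ?f = "\<lambda>i. component i y [^] n"
  have f: "?f \<in> Pi I F"
    using component_in assms summand_subgroup subgroup_int_pow_closed by blast
  have "(\<Otimes>i\<in>I. ?f i) = (\<Otimes>i\<in>I. component i y) [^] n"
    using assms component_carrier by (intro finprod_int_pow) auto
  then have eq: "(\<Otimes>i\<in>I. ?f i) = y [^] n" using finprod_component assms by simp
  show "y [^] n \<in> A" using finprod_in[OF f] eq by simp
  show "i \<in> I \<Longrightarrow> component i (y [^] n) = component i y [^] n"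
    using component_finprod[OF f] eq by simp
qed

lemma one_in: "\<one> \<in> A"
  using finprod_in[of "\<lambda>_. \<one>"] summand_subgroup subgroup.one_closed by fastforce

lemma component_one: "i \<in> I \<Longrightarrow> component i \<one> = \<one>"
  using component_int_pow[OF one_in, of i 0] by simp

lemma sum_subgroup: "subgroup A G"
proof (rule subgroupI)
  show "inv y \<in> A" if "y \<in> A" for y
    using int_pow_in[OF that, of "-1"] in_carrier[OF that] by (simp add: int_pow_neg)
qed (use in_carrier one_in mult_in in auto)

lemma component_inv: "y \<in> A \<Longrightarrow> i \<in> I \<Longrightarrow> component i (inv y) = inv (component i y)"
  using component_int_pow[of y i "-1"] in_carrier component_carrier by (simp add: int_pow_neg)

lemma component_hom: "i \<in> I \<Longrightarrow> component i \<in> hom (G\<lparr>carrier := A\<rparr>) G"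
  by (auto simp: hom_def component_carrier component_mult)

definition partial_sum :: "'i set \<Rightarrow> 'a set" where
  "partial_sum J = {y \<in> A. \<forall>i\<in>I - J. component i y = \<one>}"

lemma partial_sum_subset: "partial_sum J \<subseteq> A"
  unfolding partial_sum_def by blast

lemma partial_sum_subgroup: "subgroup (partial_sum J) G"
proof (rule subgroupI)
  show "partial_sum J \<noteq> {}" using one_in component_one unfolding partial_sum_def by blast
qed (auto simp: partial_sum_def in_carrier mult_in component_mult component_inv
    subgroup.m_inv_closed[OF sum_subgroup])

lemma finprod_in_partial_sum:
  assumes "J \<subseteq> I" "f \<in> Pi J F"
  shows "(\<Otimes>j\<in>J. f j) \<in> partial_sum J"
proof -
  let ?f = "\<lambda>j. if j \<in> J then f j else \<one>"
  have f: "?f \<in> Pi I F" using assms summand_subgroup subgroup.one_closed by fastforce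
  have "(\<Otimes>j\<in>J. f j) = (\<Otimes>j\<in>I. ?f j)"
    using assms finite_index family_carrier[OF subset_refl f]
    by (intro finprod_mono_neutral_cong_left) (auto split: if_splits)
  then show ?thesis using finprod_in[OF f] component_finprod[OF f] unfolding partial_sum_def by auto
qed

lemma finprod_split:
  assumes "J \<subseteq> I" "f \<in> Pi I F"
  shows "(\<Otimes>i\<in>I. f i) = (\<Otimes>i\<in>J. f i) \<otimes> (\<Otimes>i\<in>I - J. f i)"
proof -
  have "I = J \<union> (I - J)" using assms(1) by blast
  then show ?thesis
    using finprod_Un_disjoint[of J "I - J" f] family_carrier[OF subset_refl assms(2)] assms(1)
      finite_subset[OF assms(1) finite_index] finite_index by auto
qed

lemma partial_sum_complement:
  assumes "J \<subseteq> I"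
  shows "A = partial_sum J <#> partial_sum (I - J)"
proof
  show "A \<subseteq> partial_sum J <#> partial_sum (I - J)"
  proof
    fix y assume y: "y \<in> A"
    have c: "(\<lambda>i. component i y) \<in> Pi I F" using component_in[OF y] by blast
    have "y = (\<Otimes>i\<in>J. component i y) \<otimes> (\<Otimes>i\<in>I - J. component i y)"
      using finprod_split[OF assms c] finprod_component[OF y] by simp
    moreover have "(\<Otimes>i\<in>J. component i y) \<in> partial_sum J"
      "(\<Otimes>i\<in>I - J. component i y) \<in> partial_sum (I - J)"
      using c assms by (auto intro!: finprod_in_partial_sum)
    ultimately show "y \<in> partial_sum J <#> partial_sum (I - J)" unfolding set_mult_def by blast
  qed
qed (auto simp: set_mult_def partial_sum_def mult_in)

lemma partial_sum_Int_complement: "partial_sum J \<inter> partial_sum (I - J) = {\<one>}"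
proof -
  have "y = \<one>" if "y \<in> partial_sum J \<inter> partial_sum (I - J)" for y
  proof (rule component_eqI)
    show "component i y = component i \<one>" if "i \<in> I" for i
      using \<open>y \<in> partial_sum J \<inter> partial_sum (I - J)\<close> that component_one
      unfolding partial_sum_def by (cases "i \<in> J") auto
  qed (use that one_in in \<open>auto simp: partial_sum_def\<close>)
  then show ?thesis using subgroup.one_closed[OF partial_sum_subgroup] by blast
qed

lemma partial_sum_cancel:
  assumes "b \<in> partial_sum J" "c \<in> partial_sum (I - J)"
    and "t \<in> partial_sum J" "u \<in> partial_sum (I - J)"
    and "t \<otimes> u = b \<otimes> c"
  shows "t = b"
proof -
  interpret group_disjoint_sum G "partial_sum J" "partial_sum (I - J)"
    by (intro group_disjoint_sum.intro is_group partial_sum_subgroup)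
  show ?thesis using cancel partial_sum_Int_complement assms by blast
qed

lemma partial_sum_singleton:
  assumes "i \<in> I" shows "partial_sum {i} = F i"
proof
  show "F i \<subseteq> partial_sum {i}"
  proof
    fix y assume "y \<in> F i"
    then show "y \<in> partial_sum {i}"
      using finprod_in_partial_sum[of "{i}" "\<lambda>_. y"] assms summand_carrier[OF assms] by auto
  qed
  show "partial_sum {i} \<subseteq> F i"
  proof
    fix y assume y: "y \<in> partial_sum {i}"
    then have yA: "y \<in> A" using partial_sum_subset by blast
    have "(\<Otimes>j\<in>I. component j y) = (\<Otimes>j\<in>{i}. component j y)"
      using y assms finite_index component_carrier[OF yA]
      by (intro finprod_mono_neutral_cong_right) (auto simp: partial_sum_def)
    then have "y = component i y"
      using finprod_component[OF yA] component_carrier[OF yA assms] by simp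
    then show "y \<in> F i" using component_in[OF yA assms] by simp
  qed
qed

lemma in_summandI:
  "y \<in> A \<Longrightarrow> i \<in> I \<Longrightarrow> (\<And>j. j \<in> I \<Longrightarrow> j \<noteq> i \<Longrightarrow> component j y = \<one>) \<Longrightarrow> y \<in> F i"
  unfolding partial_sum_singleton[symmetric] by (auto simp: partial_sum_def)

lemma summand_in: "i \<in> I \<Longrightarrow> y \<in> F i \<Longrightarrow> y \<in> A"
  using partial_sum_singleton partial_sum_subset by blast

lemma component_other_summand:
  "i \<in> I \<Longrightarrow> y \<in> F i \<Longrightarrow> j \<in> I \<Longrightarrow> j \<noteq> i \<Longrightarrow> component j y = \<one>"
  using partial_sum_singleton[of i] by (auto simp: partial_sum_def)

lemma summand_Int:
  assumes "i \<in> I" "j \<in> I" "i \<noteq> j" shows "F i \<inter> F j = {\<one>}"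
proof -
  have "F j \<subseteq> partial_sum (I - {i})"
    using summand_in component_other_summand assms by (auto simp: partial_sum_def)
  then show ?thesis
    using partial_sum_Int_complement[of "{i}"] partial_sum_singleton[OF assms(1)]
      summand_subgroup[THEN subgroup.one_closed] assms by blast
qed

lemma inj_on_nontrivial_family:
  assumes "\<And>i. i \<in> I \<Longrightarrow> v i \<in> F i - {\<one>}" shows "inj_on v I"
  using assms summand_Int by (intro inj_onI) (metis Diff_iff IntI)

lemma direct_decomp_reindex:
  assumes v: "inj_on v I" and E: "\<And>i. i \<in> I \<Longrightarrow> E (v i) = F i"
  shows "direct_decomp G A (v ` I) E"
proof (rule direct_decompI)
  have family: "(\<lambda>i. f (v i)) \<in> Pi I F" if "f \<in> Pi (v ` I) E" for f
    using that E by auto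
  have reindex: "(\<Otimes>w\<in>v ` I. f w) = (\<Otimes>i\<in>I. f (v i))" if "f \<in> Pi (v ` I) E" for f
    using family_carrier[OF subset_refl family[OF that]] by (intro finprod_reindex[OF _ v]) auto
  show "(\<Otimes>w\<in>v ` I. f w) \<in> A" if "f \<in> Pi (v ` I) E" for f
    using reindex[OF that] finprod_in[OF family[OF that]] by simp
  show "f w = \<one>" if f: "f \<in> Pi (v ` I) E" "(\<Otimes>w\<in>v ` I. f w) = \<one>" and w: "w \<in> v ` I" for f w
    using w component_finprod[OF family[OF f(1)]] component_one f(2) reindex[OF f(1)] by auto
  show "\<exists>f\<in>Pi (v ` I) E. y = (\<Otimes>w\<in>v ` I. f w)" if y: "y \<in> A" for y
  proof
    let ?f = "\<lambda>w. component (the_inv_into I v w) y"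
    show f: "?f \<in> Pi (v ` I) E" using component_in[OF y] E by (auto simp: the_inv_into_f_f[OF v])
    have "(\<Otimes>i\<in>I. ?f (v i)) = (\<Otimes>i\<in>I. component i y)"
      using component_carrier[OF y] by (intro finprod_cong') (auto simp: the_inv_into_f_f[OF v])
    then show "y = (\<Otimes>w\<in>v ` I. ?f w)" using reindex[OF f] finprod_component[OF y] by simp
  qed
qed (use finite_index summand_subgroup E in auto)

end

locale torsion_free_direct_sum = torsion_free_group G + direct_sum G A I F
  for G (structure) and A I F
begin

lemma partial_sum_pure:
  assumes "y \<in> A" "y [^] (n::int) \<in> partial_sum J" "n \<noteq> 0"
  shows "y \<in> partial_sum J"
proof -
  have "component i y [^] n = \<one>" if "i \<in> I - J" for i
    using assms that component_int_pow[OF assms(1)] unfolding partial_sum_def by auto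
  then show ?thesis
    using assms(1,3) int_pow_eq_one_iff component_carrier[OF assms(1)]
    unfolding partial_sum_def by auto
qed

lemma purification_partial_sum_Int: "purification (partial_sum J) \<inter> A = partial_sum J"
  using partial_sum_pure partial_sum_subset[of J]
    subset_purification[OF subgroup.subset[OF partial_sum_subgroup[of J]]]
  by (auto elim!: purificationE)

lemma summand_pure:
  assumes "y \<in> A" "i \<in> I" "y [^] (n::int) \<in> F i" "n \<noteq> 0"
  shows "y \<in> F i"
  using partial_sum_pure[of y n "{i}"] partial_sum_singleton assms by simp

lemma purification_summand_Int: "i \<in> I \<Longrightarrow> purification (F i) \<inter> A = F i"
  using purification_partial_sum_Int[of "{i}"] partial_sum_singleton by simp

lemma direct_decomp_purification:
  "direct_decomp G ((\<lambda>f. \<Otimes>i\<in>I. f i) ` Pi I (\<lambda>i. purification (F i))) I (\<lambda>i. purification (F i))"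
proof (rule direct_decompI)
  fix f i assume f: "f \<in> Pi I (\<lambda>i. purification (F i))" and one: "(\<Otimes>i\<in>I. f i) = \<one>" and i: "i \<in> I"
  have fc: "f \<in> I \<rightarrow> carrier G" using f purification_subset_carrier by blast
  obtain k :: int where k: "k \<noteq> 0" "\<And>i. i \<in> I \<Longrightarrow> f i [^] k \<in> F i"
    using common_exponent[of I F f] finite_index summand_subgroup f by blast
  have "(\<Otimes>i\<in>I. f i [^] k) = \<one>" using finprod_int_pow[OF fc] one by simp
  then have "f i [^] k = \<one>"
    using component_finprod[of "\<lambda>i. f i [^] k" i] component_one[OF i] k(2) i by auto
  then show "f i = \<one>" using int_pow_eq_one_iff[of "f i" k] fc i k(1) by auto
qed (use finite_index purification_subgroup summand_subgroup in auto)

lemma Z_independent_nontrivial_family: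
  assumes w: "\<And>i. i \<in> I \<Longrightarrow> w i \<in> F i - {\<one>}"
  shows "Z_independent G (w ` I)"
  unfolding Z_independent_def
proof (intro conjI allI impI ballI)
  have wc: "w i \<in> carrier G" if "i \<in> I" for i using w summand_carrier that by blast
  show "w ` I \<subseteq> carrier G" using wc by blast
  fix c :: "'a \<Rightarrow> int" and b assume c: "(\<Otimes>b\<in>w ` I. b [^] c b) = \<one>" and "b \<in> w ` I"
  then obtain i where i: "i \<in> I" "b = w i" by blast
  let ?f = "\<lambda>i. w i [^] c (w i)"
  have f: "?f \<in> Pi I F" using w subgroup_int_pow_closed summand_subgroup by blast
  have inj: "inj_on w I" using inj_on_nontrivial_family[OF w] .
  have "(\<Otimes>i\<in>I. ?f i) = \<one>"
    using c wc by (subst finprod_reindex[OF _ inj, of "\<lambda>b. b [^] c b", symmetric]) auto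
  then have "?f i = \<one>" using component_finprod[OF f i(1)] component_one[OF i(1)] by simp
  then show "c b = 0" using int_pow_eq_one_iff[OF wc[OF i(1)]] w[OF i(1)] i(2) by simp
qed (use finite_index in simp)

end

section \<open>Rank\<close>

locale tffr = torsion_free_group G for G (structure) +
  assumes finite_rank: "finite_rank G"
begin

lemma card_le_rk:
  assumes "B \<subseteq> A" "Z_independent G B" shows "card B \<le> rk G A"
  unfolding rk_def
proof (rule cSup_upper)
  show "bdd_above {card B |B. B \<subseteq> A \<and> Z_independent G B}"
    using finite_rank unfolding finite_rank_def bdd_above_def by blast
qed (use assms in blast)

lemma rk_leI:
  assumes "\<And>B. B \<subseteq> A \<Longrightarrow> Z_independent G B \<Longrightarrow> card B \<le> n" shows "rk G A \<le> n"
proof -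
  have "Z_independent G {}" by (simp add: Z_independent_def)
  then show ?thesis unfolding rk_def by (intro cSup_least) (use assms in blast)+
qed

lemma rk_mono: "A \<subseteq> B \<Longrightarrow> rk G A \<le> rk G B"
  by (rule rk_leI, rule card_le_rk) auto

lemma not_Z_independent_one: "\<not> Z_independent G {\<one>}"
proof
  assume "Z_independent G {\<one>}"
  then have "\<forall>c :: 'a \<Rightarrow> int. c \<one> = 0" unfolding Z_independent_def by simp
  then have "(1::int) = 0" by (rule spec[of _ "\<lambda>_. 1"])
  then show False by simp
qed

lemma rk_trivial: "rk G {\<one>} = 0"
proof -
  have "rk G {\<one>} \<le> 0"
  proof (rule rk_leI)
    fix B assume B: "B \<subseteq> {\<one>}" "Z_independent G B"
    then have "B = {} \<or> B = {\<one>}" by blast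
    then show "card B \<le> 0" using B(2) not_Z_independent_one by auto
  qed
  then show ?thesis by simp
qed

lemma Z_independent_pow_image:
  assumes B: "Z_independent G B" and k: "k \<noteq> 0"
  shows "Z_independent G ((\<lambda>b. b [^] (k::int)) ` B)" and "inj_on (\<lambda>b. b [^] k) B"
proof -
  have Bc: "b \<in> carrier G" if "b \<in> B" for b using B that unfolding Z_independent_def by blast
  show inj: "inj_on (\<lambda>b. b [^] k) B" using int_pow_cancel Bc k by (intro inj_onI) blast
  show "Z_independent G ((\<lambda>b. b [^] k) ` B)"
    unfolding Z_independent_def
  proof (intro conjI allI impI)
    fix c :: "'a \<Rightarrow> int" assume "(\<Otimes>b\<in>(\<lambda>b. b [^] k) ` B. b [^] c b) = \<one>"
    then have "(\<Otimes>b\<in>B. (b [^] k) [^] c (b [^] k)) = \<one>"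
      using Bc by (subst (asm) finprod_reindex[OF _ inj]) auto
    moreover have "(\<Otimes>b\<in>B. (b [^] k) [^] c (b [^] k)) = (\<Otimes>b\<in>B. b [^] (k * c (b [^] k)))"
      using Bc by (intro finprod_cong') (auto simp: int_pow_pow)
    ultimately have "\<forall>b\<in>B. k * c (b [^] k) = 0" using B unfolding Z_independent_def by metis
    then show "\<forall>b\<in>(\<lambda>b. b [^] k) ` B. c b = 0" using k by simp
  qed (use B Bc in \<open>auto simp: Z_independent_def\<close>)
qed

lemma rk_purification:
  assumes A: "subgroup A G" shows "rk G (purification A) = rk G A"
proof (rule antisym)
  show "rk G (purification A) \<le> rk G A"
  proof (rule rk_leI)
    fix B assume B: "B \<subseteq> purification A" "Z_independent G B"
    then obtain k :: int where k: "k \<noteq> 0" "\<forall>b\<in>B. b [^] k \<in> A"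
      using common_exponent[of B "\<lambda>_. A" "\<lambda>b. b"] A unfolding Z_independent_def by blast
    then show "card B \<le> rk G A"
      using card_le_rk[of "(\<lambda>b. b [^] k) ` B" A] Z_independent_pow_image[OF B(2) k(1)]
      by (auto simp: card_image)
  qed
qed (rule rk_mono[OF subset_purification[OF subgroup.subset[OF A]]])

lemma rank_one_nontrivial:
  assumes "rk G A = 1" "A \<subseteq> carrier G" shows "\<exists>x\<in>A. x \<noteq> \<one>"
proof (rule ccontr)
  assume "\<not> (\<exists>x\<in>A. x \<noteq> \<one>)"
  then have "rk G A \<le> rk G {\<one>}" by (intro rk_mono) blast
  then show False using assms rk_trivial by simp
qed

lemma rank_one_dependent:
  assumes "rk G A = 1" "A \<subseteq> carrier G" and v: "v \<in> A" "v \<noteq> \<one>" and y: "y \<in> A"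
  shows "\<exists>(m::int) (n::int). 0 < n \<and> y [^] n = v [^] m"
proof (cases "y = v")
  case True
  then show ?thesis by (intro exI[of _ "1::int"]) simp
next
  case False
  have vc: "v \<in> carrier G" "y \<in> carrier G" using v y assms(2) by auto
  have "\<not> Z_independent G {y, v}" using card_le_rk[of "{y, v}" A] v y assms(1) False by auto
  moreover have "finite {y, v}" "{y, v} \<subseteq> carrier G" using vc by auto
  ultimately obtain c :: "'a \<Rightarrow> int"
    where "(\<Otimes>b\<in>{y, v}. b [^] c b) = \<one>" "\<not> (\<forall>b\<in>{y, v}. c b = 0)"
    unfolding Z_independent_def by blast
  then have c: "y [^] c y \<otimes> v [^] c v = \<one>" "c y \<noteq> 0 \<or> c v \<noteq> 0" using vc False by simp_all
  have yv: "y [^] c y = v [^] (- c v)"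
    using inv_equality[OF c(1)] vc by (simp add: int_pow_neg)
  have "y [^] (- c y) = v [^] c v" using yv vc by (simp add: int_pow_neg)
  moreover have "c y \<noteq> 0"
  proof
    assume "c y = 0"
    then have "v [^] (- c v) = \<one>" using yv by simp
    then show False using int_pow_eq_one_iff[OF vc(1)] v(2) c(2) \<open>c y = 0\<close> by simp
  qed
  then have "0 < c y \<or> 0 < - c y" by linarith
  ultimately show ?thesis using yv by blast
qed

end

locale tffr_direct_sum = tffr G + torsion_free_direct_sum G A I F
  for G (structure) and A I F
begin

lemma card_index_le_rk:
  assumes "\<And>i. i \<in> I \<Longrightarrow> F i \<noteq> {\<one>}" shows "card I \<le> rk G A"
proof -
  have "\<exists>w. \<forall>i\<in>I. w i \<in> F i - {\<one>}"
  proof (rule bchoice, rule ballI)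
    show "\<exists>x. x \<in> F i - {\<one>}" if "i \<in> I" for i
      using assms[OF that] subgroup.one_closed[OF summand_subgroup[OF that]] by blast
  qed
  then obtain w where w: "\<And>i. i \<in> I \<Longrightarrow> w i \<in> F i - {\<one>}" by blast
  have "card I = card (w ` I)" using card_image inj_on_nontrivial_family[OF w] by metis
  also have "\<dots> \<le> rk G A"
    using w summand_in by (intro card_le_rk Z_independent_nontrivial_family) auto
  finally show ?thesis .
qed

lemma in_single_summand:
  assumes P: "rk G P = 1" "P \<subseteq> carrier G"
    and y: "y \<in> A" "y \<noteq> \<one>" and comp: "\<And>i. i \<in> I \<Longrightarrow> component i y \<in> P"
  shows "\<exists>i\<in>I. y \<in> F i"
proof -
  obtain i where i: "i \<in> I" "component i y \<noteq> \<one>"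
    using component_eqI[OF y(1) one_in] component_one y(2) by auto
  have "component j y = \<one>" if j: "j \<in> I" "j \<noteq> i" for j
  proof -
    obtain m n :: int where n: "0 < n" "component j y [^] n = component i y [^] m"
      using rank_one_dependent[OF P comp[OF i(1)] i(2) comp[OF j(1)]] by blast
    then have "component j y [^] n \<in> F i"
      using subgroup_int_pow_closed[OF summand_subgroup component_in[OF y(1)]] i(1) by simp
    then have "component j y \<in> F i"
      using summand_pure[OF _ i(1)] summand_in component_in[OF y(1)] j(1) n(1) by blast
    then show ?thesis using summand_Int[OF j(1) i(1) j(2)] component_in[OF y(1) j(1)] by blast
  qed
  then show ?thesis using in_summandI[OF y(1) i(1)] i(1) by blast
qed

lemma summand_eq_if_rank_one:
  assumes A: "rk G A = 1" and i: "i \<in> I" "F i \<noteq> {\<one>}"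
  shows "F i = A"
proof
  obtain x where x: "x \<in> F i" "x \<noteq> \<one>"
    using i subgroup.one_closed[OF summand_subgroup] by blast
  show "A \<subseteq> F i"
  proof
    fix y assume y: "y \<in> A"
    obtain m n :: int where n: "0 < n" "y [^] n = x [^] m"
      using rank_one_dependent[OF A _ _ x(2) y] summand_in[OF i(1) x(1)] in_carrier by blast
    then show "y \<in> F i"
      using summand_pure[OF y i(1), of n] subgroup_int_pow_closed[OF summand_subgroup[OF i(1)] x(1)]
      by simp
  qed
qed (use summand_in i in blast)

end

section \<open>Rank-one groups and their types\<close>

lemma group_rat_group: "group (rat_group UNIV)"
proof (rule groupI)
  fix x assume "x \<in> carrier (rat_group UNIV)"
  show "\<exists>y\<in>carrier (rat_group UNIV). y \<otimes>\<^bsub>rat_group UNIV\<^esub> x = \<one>\<^bsub>rat_group UNIV\<^esub>"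
    by (rule bexI[of _ "- x"]) (simp_all add: rat_group_def)
qed (simp_all add: rat_group_def)

lemma inv_rat_group: "inv\<^bsub>rat_group UNIV\<^esub> q = - q"
proof -
  interpret Q: group "rat_group UNIV" by (rule group_rat_group)
  show ?thesis by (rule Q.inv_equality) (auto simp: rat_group_def)
qed

lemma rational_groupI:
  assumes "1 \<in> S" "\<And>p q. p \<in> S \<Longrightarrow> q \<in> S \<Longrightarrow> p + q \<in> S" "\<And>q. q \<in> S \<Longrightarrow> - q \<in> S"
  shows "rational_group S"
proof -
  interpret Q: group "rat_group UNIV" by (rule group_rat_group)
  have "subgroup S (rat_group UNIV)"
    using assms by (intro Q.subgroupI) (auto simp: inv_rat_group, auto simp: rat_group_def)
  then show ?thesis using assms(1) unfolding rational_group_def by blast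
qed

lemma rational_group_imp_group:
  assumes "rational_group S" shows "group (rat_group S)"
  using group.subgroup_imp_group[OF group_rat_group, of S] assms
  by (simp add: rational_group_def rat_group_def)

lemma rat_common_denominator:
  fixes p q :: rat
  obtains k l n :: int where "0 < n" "p = of_int k / of_int n" "q = of_int l / of_int n"
proof -
  obtain a b c d where p: "quotient_of p = (a, b)" and q: "quotient_of q = (c, d)"
    by fastforce
  have "0 < b" "0 < d" using quotient_of_denom_pos[OF p] quotient_of_denom_pos[OF q] .
  then show thesis
    using quotient_of_div[OF p] quotient_of_div[OF q]
    by (intro that[of "b * d" "a * d" "c * b"]) simp_all
qed

context torsion_free_group
begin

lemma is_rat_multiple_fraction_iff:
  assumes "v \<in> carrier G" "y \<in> carrier G" "0 < n"
  shows "is_rat_multiple G (of_int m / of_int n) v y \<longleftrightarrow> y [^] n = v [^] m"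
proof
  assume "is_rat_multiple G (of_int m / of_int n) v y"
  then obtain k l :: int where l: "0 < l" "(of_int m / of_int n :: rat) = of_int k / of_int l"
    "y [^] l = v [^] k" unfolding is_rat_multiple_def by blast
  have "(of_int (k * n) :: rat) = of_int (m * l)" using l(1,2) assms(3) by (simp add: field_simps)
  then have kn: "k * n = m * l" by linarith
  have "(y [^] n) [^] l = (y [^] l) [^] n" using assms by (simp add: int_pow_pow mult.commute)
  also have "\<dots> = (v [^] m) [^] l" using assms kn by (simp add: l(3) int_pow_pow)
  finally show "y [^] n = v [^] m" using int_pow_cancel[of "y [^] n" "v [^] m" l] assms l(1) by simp
next
  assume "y [^] n = v [^] m"
  then show "is_rat_multiple G (of_int m / of_int n) v y"
    unfolding is_rat_multiple_def using assms(3) by blast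
qed

lemma is_rat_multiple_unique:
  assumes "v \<in> carrier G" "y \<in> carrier G" "z \<in> carrier G"
    and "is_rat_multiple G q v y" "is_rat_multiple G q v z"
  shows "y = z"
proof -
  obtain m n :: int where "0 < n" "q = of_int m / of_int n" by (rule rat_common_denominator)
  then show ?thesis
    using assms int_pow_cancel[of y z n] by (simp add: is_rat_multiple_fraction_iff)
qed

lemma is_rat_multiple_coeff_unique:
  assumes "v \<in> carrier G" "v \<noteq> \<one>" "y \<in> carrier G"
    and "is_rat_multiple G p v y" "is_rat_multiple G q v y"
  shows "p = q"
proof -
  obtain k l n :: int where n: "0 < n" "p = of_int k / of_int n" "q = of_int l / of_int n"
    by (rule rat_common_denominator)
  then have "v [^] (k - l) = \<one>"
    using assms by (simp add: is_rat_multiple_fraction_iff int_pow_diff)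
  then show ?thesis using int_pow_eq_one_iff[OF assms(1)] assms(2) n by simp
qed

lemma is_rat_multiple_add:
  assumes "v \<in> carrier G" "y \<in> carrier G" "z \<in> carrier G"
    and "is_rat_multiple G p v y" "is_rat_multiple G q v z"
  shows "is_rat_multiple G (p + q) v (y \<otimes> z)"
proof -
  obtain k l n :: int where n: "0 < n" "p = of_int k / of_int n" "q = of_int l / of_int n"
    by (rule rat_common_denominator)
  have "p + q = of_int (k + l) / of_int n" using n by (simp add: add_divide_distrib)
  moreover have "(y \<otimes> z) [^] n = v [^] (k + l)"
    using assms n by (simp add: is_rat_multiple_fraction_iff int_pow_distrib int_pow_mult)
  ultimately show ?thesis
    using assms n(1) is_rat_multiple_fraction_iff[of v "y \<otimes> z" n "k + l"] by simp
qed

lemma is_rat_multiple_inv: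
  assumes "v \<in> carrier G" "y \<in> carrier G" "is_rat_multiple G q v y"
  shows "is_rat_multiple G (- q) v (inv y)"
proof -
  obtain m n :: int where n: "0 < n" "q = of_int m / of_int n" by (rule rat_common_denominator)
  have "inv y [^] n = v [^] (- m)"
    using assms n by (simp add: is_rat_multiple_fraction_iff int_pow_inv int_pow_neg)
  then show ?thesis
    using assms n is_rat_multiple_fraction_iff[of v "inv y" n "- m"] by simp
qed

lemma is_rat_multiple_self: "v \<in> carrier G \<Longrightarrow> is_rat_multiple G 1 v v"
  using is_rat_multiple_fraction_iff[of v v 1 1] by simp

lemma rational_group_coeff_group:
  assumes A: "subgroup A G" and v: "v \<in> A"
  shows "rational_group (coeff_group G A v)"
proof -
  interpret A: subgroup A G by (rule A)
  note vc = A.mem_carrier[OF v]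
  show ?thesis
    unfolding coeff_group_def
  proof (rule rational_groupI; clarsimp)
    show "\<exists>y\<in>A. is_rat_multiple G 1 v y" using is_rat_multiple_self[OF vc] v by blast
    show "\<exists>x\<in>A. is_rat_multiple G (p + q) v x"
      if "y \<in> A" "is_rat_multiple G p v y" "z \<in> A" "is_rat_multiple G q v z" for p q y z
      using is_rat_multiple_add[OF vc _ _ that(2,4)] that(1,3) by (blast intro: A.mem_carrier)
    show "\<exists>x\<in>A. is_rat_multiple G (- q) v x" if "y \<in> A" "is_rat_multiple G q v y" for q y
      using is_rat_multiple_inv[OF vc _ that(2)] that(1) by (blast intro: A.mem_carrier)
  qed
qed

definition rat_multiple :: "rat \<Rightarrow> 'a \<Rightarrow> 'a" where
  "rat_multiple q v = (THE y. y \<in> carrier G \<and> is_rat_multiple G q v y)"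

lemma rat_multiple_eq:
  assumes "v \<in> carrier G" "y \<in> carrier G" "is_rat_multiple G q v y"
  shows "rat_multiple q v = y"
  unfolding rat_multiple_def
  by (rule the_equality) (use assms is_rat_multiple_unique[OF assms(1)] in auto)

lemma
  assumes A: "subgroup A G" and v: "v \<in> A" and q: "q \<in> coeff_group G A v"
  shows rat_multiple_in: "rat_multiple q v \<in> A"
    and is_rat_multiple_rat_multiple: "is_rat_multiple G q v (rat_multiple q v)"
proof -
  obtain y where y: "y \<in> A" "is_rat_multiple G q v y" using q unfolding coeff_group_def by blast
  then have "rat_multiple q v = y" by (intro rat_multiple_eq subgroup.mem_carrier[OF A] v)
  then show "rat_multiple q v \<in> A" "is_rat_multiple G q v (rat_multiple q v)" using y by simp_all
qed

end

context tffr
begin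

lemma rank_one_is_rat_multiple:
  assumes "rk G A = 1" "A \<subseteq> carrier G" "v \<in> A" "v \<noteq> \<one>" "y \<in> A"
  shows "\<exists>q. is_rat_multiple G q v y"
  using rank_one_dependent[OF assms] unfolding is_rat_multiple_def by blast

lemma rat_multiple_iso:
  assumes rk1: "rk G A = 1" and A: "subgroup A G" and v: "v \<in> A" "v \<noteq> \<one>"
  shows "(\<lambda>q. rat_multiple q v) \<in> iso (rat_group (coeff_group G A v)) (G\<lparr>carrier := A\<rparr>)"
    (is "?h \<in> iso (rat_group ?S) _")
proof -
  interpret A: subgroup A G by (rule A)
  have vc: "v \<in> carrier G" using v(1) by (rule A.mem_carrier)
  note eq = rat_multiple_eq[OF vc]
  note mem = rat_multiple_in[OF A v(1)] is_rat_multiple_rat_multiple[OF A v(1)]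
  have add: "?h (p + q) = ?h p \<otimes> ?h q" if "p \<in> ?S" "q \<in> ?S" for p q
    by (intro eq is_rat_multiple_add vc A.m_closed A.mem_carrier mem that)
  have "inj_on ?h ?S"
  proof (rule inj_onI)
    show "p = q" if "p \<in> ?S" "q \<in> ?S" "?h p = ?h q" for p q
      using is_rat_multiple_coeff_unique[OF vc v(2) A.mem_carrier[OF mem(1)]] mem(2) that by metis
  qed
  moreover have "?h ` ?S = A"
  proof
    show "A \<subseteq> ?h ` ?S"
    proof
      fix y assume y: "y \<in> A"
      obtain q where q: "is_rat_multiple G q v y"
        using rank_one_is_rat_multiple[OF rk1 A.subset v y] by blast
      then have "q \<in> ?S" using y unfolding coeff_group_def by blast
      moreover have "?h q = y" using q by (intro eq A.mem_carrier y)
      ultimately show "y \<in> ?h ` ?S" by blast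
    qed
  qed (use mem in blast)
  ultimately have bij: "bij_betw ?h ?S A" by (simp add: bij_betw_def)
  have "?h \<in> hom (rat_group ?S) (G\<lparr>carrier := A\<rparr>)"
    by (rule homI) (simp_all add: rat_group_def mem add)
  then show ?thesis using bij by (intro isoI) (simp_all add: rat_group_def)
qed

lemma coeff_group_in_type_of:
  assumes "rk G A = 1" "subgroup A G" "v \<in> A" "v \<noteq> \<one>"
  shows "coeff_group G A v \<in> type_of G A"
  using rat_multiple_iso[OF assms] rational_group_coeff_group[OF assms(2,3)]
  unfolding type_of_def is_iso_def by blast

lemma type_of_nonempty:
  assumes "rk G A = 1" "subgroup A G" shows "type_of G A \<noteq> {}"
  using coeff_group_in_type_of[OF assms]
    rank_one_nontrivial[OF assms(1) subgroup.subset[OF assms(2)]] by blast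

lemma type_leI:
  assumes A: "rk G A = 1" "subgroup A G" and B: "rk G B = 1" "subgroup B G"
    and h: "h \<in> hom (G\<lparr>carrier := A\<rparr>) (G\<lparr>carrier := B\<rparr>)" and x: "x \<in> A" "h x \<noteq> \<one>"
  shows "type_le (type_of G A) (type_of G B)"
proof -
  obtain S T where S: "S \<in> type_of G A" and T: "T \<in> type_of G B"
    using type_of_nonempty A B by blast
  obtain f where f: "f \<in> iso (rat_group S) (G\<lparr>carrier := A\<rparr>)"
    using S unfolding type_of_def is_iso_def by auto
  have TG: "group (rat_group T)" using T rational_group_imp_group unfolding type_of_def by blast
  then obtain g where g: "g \<in> iso (G\<lparr>carrier := B\<rparr>) (rat_group T)"
    using T group.iso_sym unfolding type_of_def is_iso_def by blast
  let ?k = "g \<circ> (h \<circ> f)"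
  have k: "?k \<in> hom (rat_group S) (rat_group T)"
    by (rule Group.hom_compose[OF Group.hom_compose[OF iso_imp_homomorphism[OF f] h]
        iso_imp_homomorphism[OF g]])
  obtain s where s: "s \<in> S" "f s = x"
    using f x(1) unfolding iso_iff by (auto simp: rat_group_def)
  have "g (h x) \<noteq> 0"
    using g h x inj_on_one_iff'[OF iso_imp_homomorphism[OF g] subgroup_imp_group[OF B(2)] TG]
    unfolding iso_iff by (auto simp: hom_def rat_group_def)
  then have "?k s \<noteq> 0" using s by simp
  then show ?thesis unfolding type_le_def
    by (intro bexI[OF _ S] bexI[OF _ T] bexI[OF _ k] bexI[OF _ s(1)])
qed

lemma homogeneous_rank_one:
  assumes "homogeneous G \<rho> A" "rk G A = 1"
  shows "type_of G A = \<rho>"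
proof -
  obtain n :: nat and F where F: "direct_decomp G A {..<n} F"
    and summand: "\<forall>i<n. rk G (F i) = 1 \<and> type_of G (F i) = \<rho>"
    using assms(1) unfolding homogeneous_def by blast
  interpret A: tffr_direct_sum G A "{..<n}" F by unfold_locales (rule F)
  have "0 < n"
  proof (rule ccontr)
    assume "\<not> 0 < n"
    then have "y = \<one>" if "y \<in> A" for y
      using A.component_eqI[OF that A.one_in] by simp
    then have "A = {\<one>}" using A.one_in by blast
    then show False using assms(2) rk_trivial by simp
  qed
  then have F0: "rk G (F 0) = 1" "type_of G (F 0) = \<rho>" using summand by simp_all
  then have "F 0 \<noteq> {\<one>}" using rk_trivial by auto
  then have "F 0 = A" using A.summand_eq_if_rank_one[OF assms(2)] \<open>0 < n\<close> by simp
  then show ?thesis using F0(2) by simp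
qed

end

section \<open>Orders and divisors modulo multiples\<close>

context comm_group
begin

lemma FactGroup_pow_eq_one_iff:
  assumes H: "subgroup H G" and x: "x \<in> carrier G"
  shows "(H #> x) [^]\<^bsub>G Mod H\<^esub> (k::nat) = \<one>\<^bsub>G Mod H\<^esub> \<longleftrightarrow> x [^] k \<in> H"
proof -
  have "H #> (x [^] k) = H \<longleftrightarrow> x [^] k \<in> H"
    using coset_join1[OF _ _ H] coset_join2[OF _ H] x by blast
  then show ?thesis
    using normal.FactGroup_pow[OF subgroup_imp_normal[OF H] x] by simp
qed

lemma group_FactGroup: "subgroup H G \<Longrightarrow> group (G Mod H)"
  using abelian_FactGroup comm_group.axioms(2) by blast

lemma rcos_in_FactGroup: "x \<in> carrier G \<Longrightarrow> H #> x \<in> carrier (G Mod H)"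
  by (auto simp: carrier_FactGroup)

lemma FactGroup_ord_dvd_iff:
  assumes H: "subgroup H G" and x: "x \<in> carrier G"
  shows "group.ord (G Mod H) (H #> x) dvd k \<longleftrightarrow> x [^] k \<in> H"
  using group.pow_eq_id[OF group_FactGroup[OF H] rcos_in_FactGroup[OF x]]
    FactGroup_pow_eq_one_iff[OF H x] by simp

lemma nat_pow_image_subgroup:
  assumes "subgroup A G" shows "subgroup ((\<lambda>x. x [^] (e::nat)) ` A) G"
proof -
  interpret group_hom G G "\<lambda>x. x [^] e"
    by unfold_locales (auto simp: hom_def nat_pow_distrib)
  show ?thesis using assms by (rule subgroup_img_is_subgroup)
qed

lemma subgroup_imp_comm_group:
  assumes "subgroup A G" shows "comm_group (G\<lparr>carrier := A\<rparr>)"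
proof (rule group.group_comm_groupI)
  show "x \<otimes>\<^bsub>G\<lparr>carrier := A\<rparr>\<^esub> y = y \<otimes>\<^bsub>G\<lparr>carrier := A\<rparr>\<^esub> x"
    if "x \<in> carrier (G\<lparr>carrier := A\<rparr>)" "y \<in> carrier (G\<lparr>carrier := A\<rparr>)" for x y
    using that subgroup.mem_carrier[OF assms] by (simp add: m_comm)
qed (rule subgroup_imp_group[OF assms])

lemma ord_mod_dvd_iff:
  assumes A: "subgroup A G" and a: "a \<in> A"
  shows "ord_mod G A e a dvd k \<longleftrightarrow> (\<exists>r\<in>A. a [^] k = r [^] e)"
proof -
  let ?H = "G\<lparr>carrier := A\<rparr>" and ?eA = "(\<lambda>x. x [^] e) ` A"
  interpret H: comm_group ?H using A by (rule subgroup_imp_comm_group)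
  have "subgroup ?eA ?H"
    using H.nat_pow_image_subgroup[OF H.subgroup_self, of e]
    by (simp add: nat_pow_consistent[symmetric])
  then show ?thesis
    using H.FactGroup_ord_dvd_iff[of ?eA a k] a
    unfolding ord_mod_def Let_def by (auto simp: nat_pow_consistent[symmetric])
qed

lemma gcd_in_mult_ord_mod:
  assumes "subgroup A G" "a \<in> A" shows "gcd_in G A e a * ord_mod G A e a = e"
proof -
  have "ord_mod G A e a dvd e" using ord_mod_dvd_iff[OF assms] assms by blast
  then show ?thesis unfolding gcd_in_def by simp
qed

lemma gcd_in_dvd: "subgroup A G \<Longrightarrow> a \<in> A \<Longrightarrow> gcd_in G A e a dvd e"
  using gcd_in_mult_ord_mod by (metis dvd_triv_left)

lemma gcd_in_eq_one_iff:
  assumes "subgroup A G" "a \<in> A" "0 < e"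
  shows "gcd_in G A e a = 1 \<longleftrightarrow> ord_mod G A e a = e"
  using gcd_in_mult_ord_mod[OF assms(1,2), of e] assms(3) by (auto simp: gcd_in_def)

lemma dvd_gcd_in_nat_pow:
  assumes A: "subgroup A G" "a \<in> A" and d: "d dvd e" "0 < e"
  shows "d dvd gcd_in G A e (a [^] d)"
proof -
  let ?m = "ord_mod G A e (a [^] d)"
  obtain q where q: "e = d * q" using d(1) by (rule dvdE)
  have "(a [^] d) [^] q = a [^] e" using subgroup.mem_carrier[OF A] by (simp add: q nat_pow_pow)
  then have "?m dvd q"
    using ord_mod_dvd_iff[OF A(1) subgroup_nat_pow_closed[OF A]] A(2) by blast
  then have "d * ?m dvd gcd_in G A e (a [^] d) * ?m"
    using gcd_in_mult_ord_mod[OF A(1) subgroup_nat_pow_closed[OF A]] by (simp add: q)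
  moreover have "?m \<noteq> 0" using \<open>?m dvd q\<close> q d(2) by (intro notI) simp
  ultimately show ?thesis by simp
qed

end

section \<open>Cosets and generators modulo a subgroup\<close>

lemma (in group) set_mult_subgroup_absorb:
  "subgroup K G \<Longrightarrow> subgroup H G \<Longrightarrow> H \<subseteq> K \<Longrightarrow> K <#> H = K"
  using set_mult_subgroup_idem subgroup_incl by blast

lemma (in group) rcosets_supergroup:
  assumes K: "subgroup K G" and H: "subgroup H G" "H \<subseteq> K"
  shows "rcosets K = (\<lambda>C. K <#> C) ` (rcosets H)"
proof -
  have "K <#> (H #> x) = K #> x" if "x \<in> carrier G" for x
    using setmult_rcos_assoc[OF subgroup.subset[OF K] subgroup.subset[OF H(1)] that]
      set_mult_subgroup_absorb[OF K H] by simp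
  then show ?thesis unfolding RCOSETS_def by auto
qed

lemma (in group) subgroup_eq_if_card_rcosets_le:
  assumes K: "subgroup K G" and H: "subgroup H G" "H \<subseteq> K"
    and "finite (rcosets H)" "card (rcosets H) \<le> card (rcosets K)"
  shows "H = K"
proof
  have "inj_on (\<lambda>C. K <#> C) (rcosets H)"
    using assms card_image_le[of "rcosets H" "\<lambda>C. K <#> C"] rcosets_supergroup[OF K H]
    by (intro eq_card_imp_inj_on) auto
  moreover have "K <#> (H #> x) = K <#> (H #> \<one>)" if "x \<in> K" for x
    using setmult_rcos_assoc[OF subgroup.subset[OF K] subgroup.subset[OF H(1)]]
      set_mult_subgroup_absorb[OF K H] coset_join2[OF _ K] subgroup.one_closed[OF K]
      subgroup.mem_carrier[OF K that] that by simp
  ultimately have "H #> x = H #> \<one>" if "x \<in> K" for x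
    using rcosetsI[OF subgroup.subset[OF H(1)]] subgroup.mem_carrier[OF K that] that
    by (meson inj_onD one_closed)
  then show "K \<subseteq> H"
    using subgroup.mem_carrier[OF K] rcos_self[OF _ H(1)]
      coset_mult_one[OF subgroup.subset[OF H(1)]] by blast
qed (rule H(2))

context comm_group
begin

definition generates_mod :: "'a set \<Rightarrow> 'a \<Rightarrow> bool" where
  "generates_mod H x \<longleftrightarrow> x \<in> carrier G \<and> carrier G = H <#> range (\<lambda>k::int. x [^] k)"

lemma described_by_iff: "described_by G H e a \<longleftrightarrow> 0 < e \<and> (\<exists>x. generates_mod H x \<and> x [^] e = a)"
  unfolding described_by_def generates_mod_def by blast

lemma generates_modI:
  assumes "x \<in> carrier G" "H \<subseteq> carrier G"
    and "\<And>y. y \<in> carrier G \<Longrightarrow> \<exists>h\<in>H. \<exists>k::int. y = h \<otimes> x [^] k"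
  shows "generates_mod H x"
  unfolding generates_mod_def
proof (intro conjI subset_antisym)
  show "carrier G \<subseteq> H <#> range (\<lambda>k::int. x [^] k)"
  proof
    fix y assume "y \<in> carrier G"
    from assms(3)[OF this] show "y \<in> H <#> range (\<lambda>k::int. x [^] k)"
      unfolding set_mult_def by auto
  qed
  show "H <#> range (\<lambda>k::int. x [^] k) \<subseteq> carrier G" using assms(1,2) by (intro set_mult_closed) auto
qed (rule assms(1))

lemma generates_modD:
  assumes "generates_mod H x" "y \<in> carrier G"
  shows "\<exists>h\<in>H. \<exists>k::int. y = h \<otimes> x [^] k"
proof -
  have "y \<in> H <#> range (\<lambda>k::int. x [^] k)" using assms unfolding generates_mod_def by simp
  then show ?thesis unfolding set_mult_def by blast
qed

lemma generates_mod_mono: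
  assumes "generates_mod H x" "H \<subseteq> K" "K \<subseteq> carrier G" shows "generates_mod K x"
proof (rule generates_modI)
  show "x \<in> carrier G" using assms(1) unfolding generates_mod_def by blast
  show "\<exists>h\<in>K. \<exists>k::int. y = h \<otimes> x [^] k" if "y \<in> carrier G" for y
    using generates_modD[OF assms(1) that] assms(2) by blast
qed (rule assms(3))

lemma generates_mod_mult:
  assumes H: "subgroup H G" and x: "generates_mod H x" and s: "s \<in> H"
  shows "generates_mod H (x \<otimes> s)"
proof (rule generates_modI)
  have xc: "x \<in> carrier G" using x unfolding generates_mod_def by blast
  note sc = subgroup.mem_carrier[OF H s]
  show "x \<otimes> s \<in> carrier G" using xc sc by simp
  fix y assume "y \<in> carrier G"
  then obtain h and k :: int where h: "h \<in> H" "y = h \<otimes> x [^] k" using generates_modD[OF x] by blast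
  have "(h \<otimes> s [^] (- k)) \<otimes> (x \<otimes> s) [^] k = h \<otimes> (s [^] (- k) \<otimes> (s [^] k \<otimes> x [^] k))"
    using xc sc subgroup.mem_carrier[OF H h(1)] by (simp add: m_assoc int_pow_distrib m_comm)
  also have "\<dots> = y"
    using xc sc subgroup.mem_carrier[OF H h(1)] h(2) by (simp add: int_pow_neg m_assoc[symmetric])
  finally have "y = (h \<otimes> s [^] (- k)) \<otimes> (x \<otimes> s) [^] k" by simp
  moreover have "h \<otimes> s [^] (- k) \<in> H"
    using subgroup.m_closed[OF H h(1) subgroup_int_pow_closed[OF H s]] .
  ultimately show "\<exists>h\<in>H. \<exists>k::int. y = h \<otimes> (x \<otimes> s) [^] k" by blast
qed (rule subgroup.subset[OF H])

lemma described_by_mult_pow: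
  assumes H: "subgroup H G" and "described_by G H e a" and s: "s \<in> H"
  shows "described_by G H e (a \<otimes> s [^] e)"
proof -
  obtain x where x: "generates_mod H x" "x [^] e = a" and e: "0 < e"
    using assms(2) unfolding described_by_iff by blast
  then have "(x \<otimes> s) [^] e = a \<otimes> s [^] e"
    using subgroup.mem_carrier[OF H s] by (auto simp: generates_mod_def nat_pow_distrib)
  then show ?thesis unfolding described_by_iff using generates_mod_mult[OF H x(1) s] e by blast
qed

lemma described_by_nat_pow_in:
  assumes H: "subgroup H G" and "described_by G H e a" "a \<in> H" and y: "y \<in> carrier G"
  shows "y [^] e \<in> H"
proof -
  obtain x where x: "generates_mod H x" "x [^] e \<in> H"
    using assms(2,3) unfolding described_by_iff by blast
  then have xc: "x \<in> carrier G" unfolding generates_mod_def by blast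
  obtain h and k :: int where h: "h \<in> H" "y = h \<otimes> x [^] k" using generates_modD[OF x(1) y] by blast
  have "y [^] e = h [^] e \<otimes> (x [^] e) [^] k"
    using xc subgroup.mem_carrier[OF H h(1)]
    by (simp add: h(2) int_pow_distrib int_pow_pow mult.commute flip: int_pow_int)
  then show ?thesis
    using subgroup.m_closed[OF H subgroup_nat_pow_closed[OF H h(1)]
        subgroup_int_pow_closed[OF H x(2)]] by simp
qed

lemma generates_mod_iff_FactGroup:
  assumes H: "subgroup H G" and x: "x \<in> carrier G"
  shows "generates_mod H x \<longleftrightarrow> carrier (G Mod H) = range (\<lambda>k::int. (H #> x) [^]\<^bsub>G Mod H\<^esub> k)"
proof -
  have coset: "(\<exists>h\<in>H. y = h \<otimes> x [^] k) \<longleftrightarrow> H #> y = H #> (x [^] k)"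
    if "y \<in> carrier G" for y and k :: int
    using that x H repr_independence[of y H "x [^] k"] rcos_self[of y H]
    by (auto simp: r_coset_def)
  have "generates_mod H x \<longleftrightarrow> (\<forall>y\<in>carrier G. \<exists>k::int. H #> y = H #> (x [^] k))"
    using generates_modI[OF x subgroup.subset[OF H]] generates_modD coset by metis
  also have "\<dots> \<longleftrightarrow> carrier (G Mod H) \<subseteq> range (\<lambda>k::int. H #> (x [^] k))"
    unfolding carrier_FactGroup by blast
  also have "\<dots> \<longleftrightarrow> carrier (G Mod H) = range (\<lambda>k::int. H #> (x [^] k))"
    using rcos_in_FactGroup x by auto
  finally show ?thesis
    using normal.FactGroup_int_pow[OF subgroup_imp_normal[OF H] x] by simp
qed

lemma ex_generates_mod:
  assumes H: "subgroup H G" and "cyclic_group (G Mod H)"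
  shows "\<exists>x. generates_mod H x"
proof -
  obtain C where C: "C \<in> carrier (G Mod H)"
    and gen: "carrier (G Mod H) = range (\<lambda>k::int. C [^]\<^bsub>G Mod H\<^esub> k)"
    using assms(2) unfolding group.cyclic_group[OF group_FactGroup[OF H]] by blast
  obtain x where "x \<in> carrier G" "C = H #> x" using C unfolding carrier_FactGroup by blast
  then show ?thesis using generates_mod_iff_FactGroup[OF H] gen by blast
qed

lemma generator_nat_pow_in_iff:
  assumes H: "subgroup H G" and x: "generates_mod H x"
  shows "x [^] (k::nat) \<in> H \<longleftrightarrow> card (rcosets H) dvd k"
proof -
  have xc: "x \<in> carrier G" using x unfolding generates_mod_def by blast
  interpret Q: group "G Mod H" using H by (rule group_FactGroup)
  note C = rcos_in_FactGroup[OF xc, of H]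
  have "carrier (G Mod H) = generate (G Mod H) {H #> x}"
    using x Q.generate_pow[OF C] unfolding generates_mod_iff_FactGroup[OF H xc] by auto
  then have "Q.ord (H #> x) = card (rcosets H)"
    using Q.generate_pow_card[OF C] by (simp add: FactGroup_def)
  then show ?thesis using FactGroup_ord_dvd_iff[OF H xc] by simp
qed

lemma nat_pow_index_in:
  assumes H: "subgroup H G" and x: "x \<in> carrier G"
  shows "x [^] card (rcosets H) \<in> H"
proof -
  interpret Q: group "G Mod H" using H by (rule group_FactGroup)
  have "(H #> x) [^]\<^bsub>G Mod H\<^esub> order (G Mod H) = \<one>\<^bsub>G Mod H\<^esub>"
    using rcos_in_FactGroup[OF x] by (rule Q.pow_order_eq_1)
  then show ?thesis
    using FactGroup_pow_eq_one_iff[OF H x] by (simp add: order_def FactGroup_def)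
qed

end

section \<open>Regulating subgroups\<close>

lemma almost_completely_decomposable_imp_tffr:
  "almost_completely_decomposable G \<Longrightarrow> tffr G"
  by (simp add: almost_completely_decomposable_def tffr_group_def tffr_def torsion_free_group_def
      torsion_free_group_axioms_def tffr_axioms_def)

context tffr
begin

lemma regulating_summand_pure:
  assumes W: "regulating G W" and F: "direct_decomp G W {..<n::nat} F"
    and rk1: "\<forall>i<n. rk G (F i) = 1" and i: "i < n"
  shows "purification (F i) = F i"
proof -
  interpret W: tffr_direct_sum G W "{..<n}" F by unfold_locales (rule F)
  define W' where "W' = (\<lambda>f. \<Otimes>i\<in>{..<n}. f i) ` Pi {..<n} (\<lambda>i. purification (F i))"
  have W': "direct_decomp G W' {..<n} (\<lambda>i. purification (F i))"
    unfolding W'_def by (rule W.direct_decomp_purification)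
  interpret W': direct_sum G W' "{..<n}" "\<lambda>i. purification (F i)" by unfold_locales (rule W')
  have "W \<subseteq> W'"
  proof
    fix w assume w: "w \<in> W"
    have "(\<lambda>i. W.component i w) \<in> Pi {..<n} (\<lambda>i. purification (F i))"
      using W.component_in[OF w] subset_purification[OF W.summand_carrier] by blast
    then show "w \<in> W'" using W'.finprod_in W.finprod_component[OF w] by metis
  qed
  note supergroup = W'.sum_subgroup W.sum_subgroup \<open>W \<subseteq> W'\<close>
  have finite: "finite (rcosets W)" using W unfolding regulating_def finite_index_cd_def by blast
  have "finite_index_cd G W'"
    unfolding finite_index_cd_def completely_decomposable_def
  proof (intro conjI exI)
    show "direct_decomp G W' {..<n} (\<lambda>i. purification (F i))" by (rule W')
    show "\<forall>i<n. rk G (purification (F i)) = 1"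
      using rk_purification[OF W.summand_subgroup] rk1 by simp
    show "finite (rcosets W')" using rcosets_supergroup[OF supergroup] finite by simp
  qed (rule W'.sum_subgroup)
  then have "card (rcosets W) \<le> card (rcosets W')" using W unfolding regulating_def by blast
  then have "W = W'" by (rule subgroup_eq_if_card_rcosets_le[OF supergroup finite])
  then show ?thesis
    using W.purification_summand_Int[of i] W'.summand_in[of i] i by blast
qed

lemma ex_regulating:
  assumes "almost_completely_decomposable G" shows "\<exists>W. regulating G W"
proof -
  obtain W where "finite_index_cd G W"
    using assms unfolding almost_completely_decomposable_def by blast
  then show ?thesis unfolding regulating_def
    using ex_has_least_nat[of "finite_index_cd G" W "\<lambda>W. card (rcosets W)"] by blast
qed

lemma regulator_exponent:
  assumes "almost_completely_decomposable G"
  shows "\<exists>n::nat. 0 < n \<and> (\<forall>x\<in>carrier G. x [^] n \<in> regulator G)"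
proof -
  obtain W where W: "regulating G W" using ex_regulating[OF assms] by blast
  let ?n = "card (rcosets W)"
  have subgroup: "subgroup W' G" if "regulating G W'" for W'
    using that unfolding regulating_def finite_index_cd_def by blast
  have "x [^] ?n \<in> W'" if W': "regulating G W'" and x: "x \<in> carrier G" for x W'
  proof -
    have "card (rcosets W') = ?n" using W W' unfolding regulating_def by (meson le_antisym)
    then show ?thesis using nat_pow_index_in[OF subgroup[OF W'] x] by simp
  qed
  moreover have "finite (rcosets W)" "rcosets W \<noteq> {}"
    using W subgroup.rcosets_non_empty unfolding regulating_def finite_index_cd_def
    by (auto simp: RCOSETS_def)
  then have "0 < ?n" by (simp add: card_gt_0_iff)
  ultimately show ?thesis unfolding regulator_def by (intro exI[of _ ?n]) auto
qed

end

section \<open>Orders of partial sums\<close>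

context torsion_free_direct_sum
begin

lemma set_mult_purification_complement:
  assumes "J \<subseteq> I"
  shows "A <#> purification (partial_sum (I - J)) =
    partial_sum J <#> purification (partial_sum (I - J))" (is "A <#> ?K = _")
proof -
  note carrier = subgroup.subset[OF partial_sum_subgroup]
  have K: "subgroup ?K G" by (intro purification_subgroup partial_sum_subgroup)
  have "A <#> ?K = (partial_sum J <#> partial_sum (I - J)) <#> ?K"
    using partial_sum_complement[OF assms] by simp
  also have "\<dots> = partial_sum J <#> (?K <#> partial_sum (I - J))"
    using set_mult_assoc[OF carrier carrier subgroup.subset[OF K]]
      commut_normal[OF partial_sum_subgroup subgroup_imp_normal[OF K]] by simp
  also have "?K <#> partial_sum (I - J) = ?K"
    by (rule set_mult_subgroup_absorb[OF K partial_sum_subgroup subset_purification[OF carrier]])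
  finally show ?thesis .
qed

lemma nat_pow_partial_sum_cancel:
  assumes t: "t \<in> partial_sum J" and z: "z \<in> purification (partial_sum (I - J))"
    and b: "b \<in> partial_sum J" and c: "c \<in> partial_sum (I - J)"
    and eq: "(t \<otimes> z) [^] (e::nat) = b \<otimes> c"
  shows "t [^] e = b"
proof -
  have te: "t [^] e \<in> partial_sum J" by (rule subgroup_nat_pow_closed[OF partial_sum_subgroup t])
  have carriers: "t \<in> carrier G" "z \<in> carrier G" "b \<in> carrier G" "c \<in> carrier G"
    using t z b c partial_sum_subset in_carrier purification_subset_carrier by blast+
  then have tz: "t [^] e \<otimes> z [^] e = b \<otimes> c" using eq by (simp add: nat_pow_distrib)
  then have "z [^] e = inv (t [^] e) \<otimes> (b \<otimes> c)" using carriers by (simp add: inv_solve_left)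
  moreover have "b \<in> A" "c \<in> A" "t [^] e \<in> A" using b c te partial_sum_subset by blast+
  ultimately have "z [^] e \<in> A" using mult_in subgroup.m_inv_closed[OF sum_subgroup] by simp
  moreover have "z [^] e \<in> purification (partial_sum (I - J))"
    using subgroup_nat_pow_closed[OF purification_subgroup[OF partial_sum_subgroup] z] .
  ultimately have "z [^] e \<in> partial_sum (I - J)"
    using purification_partial_sum_Int[of "I - J"] by blast
  then show ?thesis using partial_sum_cancel[OF b c te] tz by blast
qed

lemma partial_sum_multiple_iff:
  assumes J: "J \<subseteq> I" and b: "b \<in> partial_sum J" and c: "c \<in> partial_sum (I - J)"
    and y: "y \<in> carrier G" "y [^] e = b \<otimes> c" and e: "0 < (e::nat)"
  shows "(\<exists>s\<in>A. b = s [^] e) \<longleftrightarrow> y \<in> A <#> purification (partial_sum (I - J))"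
proof
  assume "\<exists>s\<in>A. b = s [^] e"
  then obtain s where s: "s \<in> A" "b = s [^] e" by blast
  note sc = in_carrier[OF s(1)]
  have "c \<in> carrier G" using c partial_sum_subset in_carrier by blast
  then have "(inv s \<otimes> y) [^] e = c"
    using sc y s(2) by (simp add: nat_pow_distrib nat_pow_inv flip: m_assoc)
  then have "inv s \<otimes> y \<in> purification (partial_sum (I - J))"
    using purification_natI[of "inv s \<otimes> y" e] c sc y(1) e by simp
  moreover have "y = s \<otimes> (inv s \<otimes> y)" using sc y(1) by (simp flip: m_assoc)
  ultimately show "y \<in> A <#> purification (partial_sum (I - J))"
    using s(1) unfolding set_mult_def by blast
next
  assume "y \<in> A <#> purification (partial_sum (I - J))"
  then obtain t z where t: "t \<in> partial_sum J" and "z \<in> purification (partial_sum (I - J))"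
    and "y = t \<otimes> z"
    unfolding set_mult_purification_complement[OF J] by (auto simp: set_mult_def)
  then have "t [^] e = b" using nat_pow_partial_sum_cancel[OF t _ b c] y(2) by blast
  then show "\<exists>s\<in>A. b = s [^] e" using t partial_sum_subset by blast
qed

lemma ord_mod_partial_finprod:
  assumes J: "J \<subseteq> I" and a: "a \<in> Pi I F" and desc: "described_by G A e (\<Otimes>i\<in>I. a i)"
  shows "ord_mod G A e (\<Otimes>i\<in>J. a i) = card (rcosets (A <#> purification (partial_sum (I - J))))"
    (is "ord_mod G A e ?b = card (rcosets ?H)")
proof -
  let ?c = "\<Otimes>i\<in>I - J. a i"
  obtain x where x: "generates_mod A x" "x [^] e = (\<Otimes>i\<in>I. a i)" and e: "0 < e"
    using desc unfolding described_by_iff by blast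
  have xc: "x \<in> carrier G" using x(1) unfolding generates_mod_def by blast
  have b: "?b \<in> partial_sum J" and c: "?c \<in> partial_sum (I - J)"
    using a J by (auto intro!: finprod_in_partial_sum)
  have bA: "?b \<in> A" and cA: "?c \<in> A" using b c partial_sum_subset by blast+
  have K: "subgroup (purification (partial_sum (I - J))) G"
    by (intro purification_subgroup partial_sum_subgroup)
  have H: "subgroup ?H G" by (rule mult_subgroups[OF sum_subgroup K])
  have "A \<subseteq> ?H"
    using in_carrier subgroup.one_closed[OF K] unfolding set_mult_def by fastforce
  then have gen: "generates_mod ?H x"
    using generates_mod_mono[OF x(1)] subgroup.subset[OF H] by blast
  have "ord_mod G A e ?b dvd k \<longleftrightarrow> card (rcosets ?H) dvd k" for k
  proof -
    have "(x [^] k) [^] e = (x [^] e) [^] k" using xc by (simp add: nat_pow_pow mult.commute)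
    also have "x [^] e = ?b \<otimes> ?c" unfolding x(2) by (rule finprod_split[OF J a])
    also have "(?b \<otimes> ?c) [^] k = ?b [^] k \<otimes> ?c [^] k"
      by (intro nat_pow_distrib in_carrier bA cA)
    finally have "(\<exists>s\<in>A. ?b [^] k = s [^] e) \<longleftrightarrow> x [^] k \<in> ?H"
      using subgroup_nat_pow_closed[OF partial_sum_subgroup] b c xc e
      by (intro partial_sum_multiple_iff[OF J]) auto
    then show ?thesis
      unfolding ord_mod_dvd_iff[OF sum_subgroup bA] generator_nat_pow_in_iff[OF H gen, symmetric] .
  qed
  then show ?thesis by (meson dvd_antisym dvd_refl)
qed

lemma ord_mod_component:
  assumes "i \<in> I" "a \<in> Pi I F" "described_by G A e (\<Otimes>i\<in>I. a i)"
  shows "ord_mod G A e (a i) = card (rcosets (A <#> purification (partial_sum (I - {i}))))"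
  using ord_mod_partial_finprod[of "{i}" a e] assms summand_carrier by fastforce

lemma gcd_in_omit_component:
  assumes i: "i \<in> I" "purification (F i) = F i" and a: "a \<in> Pi I F"
    and e: "e = card (rcosets A)" and desc: "described_by G A e (\<Otimes>i\<in>I. a i)"
  shows "gcd_in G A e (\<Otimes>j\<in>I - {i}. a j) = 1"
proof -
  have J: "I - {i} \<subseteq> I" "I - (I - {i}) = {i}" using i(1) by auto
  have "A <#> F i = A"
    using set_mult_subgroup_absorb[OF sum_subgroup summand_subgroup] summand_in i(1) by blast
  then have "ord_mod G A e (\<Otimes>j\<in>I - {i}. a j) = e"
    using ord_mod_partial_finprod[OF J(1) a desc] by (simp add: J(2) partial_sum_singleton i e)
  moreover have "(\<Otimes>j\<in>I - {i}. a j) \<in> A"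
    using finprod_in_partial_sum[OF J(1), of a] partial_sum_subset a by blast
  ultimately show ?thesis
    using gcd_in_eq_one_iff[OF sum_subgroup] desc unfolding described_by_iff by blast
qed

end

section \<open>Direct sums of rank-one groups of incomparable types\<close>

locale rigid_decomposition = tffr_direct_sum G R T F
  for G (structure) and R and T :: "rtype set" and F +
  assumes rank_one: "\<rho> \<in> T \<Longrightarrow> rk G (F \<rho>) = 1"
    and summand_type: "\<rho> \<in> T \<Longrightarrow> type_of G (F \<rho>) = \<rho>"
    and antichain: "\<lbrakk>\<sigma> \<in> T; \<tau> \<in> T; type_le \<sigma> \<tau>\<rbrakk> \<Longrightarrow> \<sigma> = \<tau>"
    and bounded_quotient: "\<exists>n::nat. 0 < n \<and> (\<forall>x\<in>carrier G. x [^] n \<in> R)"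
begin

lemma summand_nontrivial: "\<rho> \<in> T \<Longrightarrow> \<exists>v\<in>F \<rho>. v \<noteq> \<one>"
  using rank_one_nontrivial rank_one summand_carrier by blast

lemma carrier_eq_purification: "carrier G = purification R"
  using bounded_quotient purification_natI purification_subset_carrier by blast

text \<open>
  Multiplied into \<open>R\<close>, the homomorphism has components of type \<open>\<tau> \<rightarrow> \<sigma>\<close>, which vanish for
  \<open>\<sigma> \<noteq> \<tau>\<close>.
\<close>

lemma hom_image_in_purification:
  assumes \<tau>: "\<tau> \<in> T" and A: "rk G A = 1" "subgroup A G" "type_of G A = \<tau>"
    and h: "h \<in> hom (G\<lparr>carrier := A\<rparr>) G" and s: "s \<in> A"
  shows "h s \<in> purification (F \<tau>)"
proof -
  obtain n :: nat where n: "0 < n" "\<And>x. x \<in> carrier G \<Longrightarrow> x [^] n \<in> R"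
    using bounded_quotient by blast
  have hc: "h t \<in> carrier G" if "t \<in> A" for t using h that by (auto simp: hom_def)
  have "h s [^] n \<in> F \<tau>"
  proof (rule in_summandI[OF n(2)[OF hc[OF s]] \<tau>], rule ccontr)
    fix \<sigma> assume \<sigma>: "\<sigma> \<in> T" "\<sigma> \<noteq> \<tau>" and nontrivial: "component \<sigma> (h s [^] n) \<noteq> \<one>"
    have hom: "(\<lambda>t. component \<sigma> (h t [^] n)) \<in> hom (G\<lparr>carrier := A\<rparr>) (G\<lparr>carrier := F \<sigma>\<rparr>)"
      by (intro homI)
        (simp_all add: component_in \<sigma>(1) n(2) hc hom_mult[OF h, simplified] nat_pow_distrib
          component_mult)
    have "type_le \<tau> \<sigma>"
      using type_leI[OF A(1,2) rank_one[OF \<sigma>(1)] summand_subgroup[OF \<sigma>(1)] hom s nontrivial]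
        A(3) summand_type[OF \<sigma>(1)] by simp
    then show False using antichain \<tau> \<sigma> by blast
  qed
  then show ?thesis using purification_natI[OF hc[OF s] _ n(1)] by blast
qed

lemma subset_summand_of_type:
  assumes "\<tau> \<in> T" "rk G A = 1" "subgroup A G" "type_of G A = \<tau>" "A \<subseteq> R"
  shows "A \<subseteq> F \<tau>"
proof -
  have "(\<lambda>x. x) \<in> hom (G\<lparr>carrier := A\<rparr>) G"
    using subgroup.subset[OF assms(3)] by (auto simp: hom_def)
  then have "A \<subseteq> purification (F \<tau>)" using hom_image_in_purification[OF assms(1-4)] by blast
  then show ?thesis using purification_summand_Int[OF assms(1)] assms(5) by blast
qed

lemma decomposition_unique:
  assumes "rigid_decomposition G R T F'" "\<rho> \<in> T"
  shows "F' \<rho> = F \<rho>"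
proof
  interpret F': rigid_decomposition G R T F' by (rule assms)
  show "F' \<rho> \<subseteq> F \<rho>"
    using subset_summand_of_type assms F'.rank_one F'.summand_type F'.summand_subgroup
      F'.summand_in by blast
  show "F \<rho> \<subseteq> F' \<rho>"
    using F'.subset_summand_of_type assms rank_one summand_type summand_subgroup summand_in by blast
qed

lemma regulator_summand_pure:
  assumes R: "R = regulator G" and \<tau>: "\<tau> \<in> T"
  shows "purification (F \<tau>) = F \<tau>"
proof -
  have P: "rk G (purification (F \<tau>)) = 1"
    using rk_purification[OF summand_subgroup[OF \<tau>]] rank_one[OF \<tau>] by simp
  have "y \<in> W" if y: "y \<in> purification (F \<tau>)" "y \<noteq> \<one>" and W: "regulating G W" for y W
  proof -
    obtain n :: nat and E where E: "direct_decomp G W {..<n} E" "\<forall>i<n. rk G (E i) = 1"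
      using W unfolding regulating_def finite_index_cd_def completely_decomposable_def by blast
    interpret W: tffr_direct_sum G W "{..<n}" E by unfold_locales (rule E(1))
    have RW: "F \<tau> \<subseteq> W" using W R summand_in[OF \<tau>] unfolding regulator_def by blast
    obtain k :: int where k: "y \<in> carrier G" "k \<noteq> 0" "y [^] k \<in> F \<tau>"
      using y(1) by (rule purificationE)
    have "W.component i (y [^] k) \<in> purification (F \<tau>)" if i: "i \<in> {..<n}" for i
    proof -
      have "W.component i \<in> hom (G\<lparr>carrier := F \<tau>\<rparr>) G"
        using W.component_hom[OF i] RW by (auto simp: hom_def Pi_iff subset_iff)
      then show ?thesis
        using hom_image_in_purification[OF \<tau> rank_one[OF \<tau>] summand_subgroup[OF \<tau>]
            summand_type[OF \<tau>] _ k(3)] by blast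
    qed
    moreover have "y [^] k \<noteq> \<one>" using int_pow_eq_one_iff[OF k(1)] k(2) y(2) by blast
    ultimately obtain i where i: "i < n" "y [^] k \<in> E i"
      using W.in_single_summand[OF P purification_subset_carrier] RW k(3) by blast
    then have "y \<in> E i"
      using regulating_summand_pure[OF W E i(1)] purificationI[OF k(1) i(2) k(2)] by simp
    then show "y \<in> W" using W.summand_in i(1) by blast
  qed
  then have "purification (F \<tau>) \<subseteq> R" using R one_in unfolding regulator_def by blast
  then show ?thesis using purification_summand_Int[OF \<tau>] by blast
qed

lemma
  assumes \<rho>: "\<rho> \<in> T" and v: "v \<in> F \<rho>" "v \<noteq> \<one>"
  shows coeff_group_in: "coeff_group G R v \<in> \<rho>"
    and rat_multiples_eq: "rat_multiples G (coeff_group G R v) v = F \<rho>"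
proof -
  note vc = subsetD[OF summand_carrier[OF \<rho>] v(1)]
  have in_summand: "y \<in> F \<rho>" if y: "y \<in> R" "is_rat_multiple G q v y" for q y
  proof -
    obtain m n :: int where "0 < n" "y [^] n = v [^] m"
      using y unfolding is_rat_multiple_def by auto
    then show ?thesis
      using summand_pure[OF y(1) \<rho>, of n] subgroup_int_pow_closed[OF summand_subgroup[OF \<rho>] v(1)]
      by auto
  qed
  then have "coeff_group G R v = coeff_group G (F \<rho>) v"
    using summand_in[OF \<rho>] unfolding coeff_group_def by blast
  then show "coeff_group G R v \<in> \<rho>"
    using coeff_group_in_type_of[OF rank_one[OF \<rho>] summand_subgroup[OF \<rho>] v] summand_type[OF \<rho>]
    by simp
  show "rat_multiples G (coeff_group G R v) v = F \<rho>"
  proof (intro subset_antisym subsetI)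
    fix y assume "y \<in> rat_multiples G (coeff_group G R v) v"
    then obtain q z where "y \<in> carrier G" "is_rat_multiple G q v y"
      and z: "z \<in> R" "is_rat_multiple G q v z"
      unfolding rat_multiples_def coeff_group_def by blast
    then have "y = z" using is_rat_multiple_unique[OF vc] in_carrier by blast
    then show "y \<in> F \<rho>" using in_summand z by blast
  next
    fix y assume y: "y \<in> F \<rho>"
    then obtain q where "is_rat_multiple G q v y"
      using rank_one_is_rat_multiple[OF rank_one[OF \<rho>] summand_carrier[OF \<rho>] v] by blast
    then show "y \<in> rat_multiples G (coeff_group G R v) v"
      using y summand_in[OF \<rho> y] summand_carrier[OF \<rho>]
      unfolding rat_multiples_def coeff_group_def by blast
  qed
qed

lemma
  assumes v: "\<And>\<rho>. \<rho> \<in> T \<Longrightarrow> v \<rho> \<in> F \<rho> - {\<one>}"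
  shows decomposition_basis_family: "decomposition_basis G R (v ` T)"
    and direct_decomp_rat_multiples:
      "direct_decomp G R T (\<lambda>\<rho>. rat_multiples G (coeff_group G R (v \<rho>)) (v \<rho>))"
proof -
  have eq: "rat_multiples G (coeff_group G R (v \<rho>)) (v \<rho>) = F \<rho>" if "\<rho> \<in> T" for \<rho>
    using rat_multiples_eq[OF that] v[OF that] by blast
  show "direct_decomp G R T (\<lambda>\<rho>. rat_multiples G (coeff_group G R (v \<rho>)) (v \<rho>))"
    using direct_decomp_reindex[of "\<lambda>\<rho>. \<rho>", OF _ eq] by simp
  show "decomposition_basis G R (v ` T)"
    unfolding decomposition_basis_def
  proof (intro conjI)
    show "v ` T \<subseteq> R - {\<one>}" using v summand_in by auto
    show "direct_decomp G R (v ` T) (\<lambda>v. rat_multiples G (coeff_group G R v) v)"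
      by (rule direct_decomp_reindex[OF inj_on_nontrivial_family[OF v] eq])
    show "\<forall>w\<in>v ` T. rk G (rat_multiples G (coeff_group G R w) w) = 1"
      using eq rank_one by auto
  qed
qed

lemma ex_description:
  assumes "cyclic_group (G Mod R)"
  shows "\<exists>a\<in>Pi T F. described_by G R (card (rcosets R)) (\<Otimes>\<rho>\<in>T. a \<rho>)"
proof -
  let ?e = "card (rcosets R)"
  obtain x where x: "generates_mod R x" using ex_generates_mod[OF sum_subgroup assms] by blast
  then have xc: "x \<in> carrier G" unfolding generates_mod_def by blast
  obtain n :: nat where "0 < n" "x [^] n \<in> R" using bounded_quotient xc by blast
  then have "0 < ?e" using generator_nat_pow_in_iff[OF sum_subgroup x] by (intro Nat.gr0I) simp
  moreover have xe: "x [^] ?e \<in> R" by (rule nat_pow_index_in[OF sum_subgroup xc])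
  ultimately have "described_by G R ?e (\<Otimes>\<rho>\<in>T. component \<rho> (x [^] ?e))"
    unfolding described_by_iff finprod_component[OF xe] using x by blast
  moreover have "(\<lambda>\<rho>. component \<rho> (x [^] ?e)) \<in> Pi T F" using component_in[OF xe] by blast
  ultimately show ?thesis by (rule bexI)
qed

lemma ex_gcd_root:
  assumes \<rho>: "\<rho> \<in> T" and a: "a \<in> F \<rho>" and e: "0 < e"
  shows "\<exists>v\<in>F \<rho> - {\<one>}. \<exists>s\<in>F \<rho>. v [^] gcd_in G R e a = a \<otimes> s [^] e"
proof -
  let ?d = "gcd_in G R e a" and ?m = "ord_mod G R e a"
  have aR: "a \<in> R" using summand_in[OF \<rho> a] .
  have dm: "?d * ?m = e" by (rule gcd_in_mult_ord_mod[OF sum_subgroup aR])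
  have m: "0 < ?m" using dm e by (intro Nat.gr0I) simp
  show ?thesis
  proof (cases "a = \<one>")
    case True
    have "a [^] (1::nat) = \<one> [^] e" using True by simp
    then have "?m dvd 1" unfolding ord_mod_dvd_iff[OF sum_subgroup aR] using one_in by blast
    then have "?d = e" using dm by simp
    moreover obtain v where v: "v \<in> F \<rho>" "v \<noteq> \<one>" using summand_nontrivial[OF \<rho>] by blast
    ultimately have "v [^] ?d = a \<otimes> v [^] e"
      using True subsetD[OF summand_carrier[OF \<rho>] v(1)] by simp
    then show ?thesis using v by blast
  next
    case False
    obtain r where r: "r \<in> R" "a [^] ?m = r [^] e"
      using ord_mod_dvd_iff[OF sum_subgroup aR, of e ?m] by auto
    note rc = in_carrier[OF r(1)] and ac = in_carrier[OF aR]
    have "a [^] ?m = (r [^] ?d) [^] ?m" using r(2) rc dm by (simp add: nat_pow_pow)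
    then have rd: "r [^] ?d = a" using nat_pow_cancel[OF ac _ _ m, of "r [^] ?d"] rc by simp
    have "r [^] int e \<in> F \<rho>"
      using r(2) subgroup_nat_pow_closed[OF summand_subgroup[OF \<rho>] a, of ?m]
      by (simp add: int_pow_int)
    then have "r \<in> F \<rho>" using summand_pure[OF r(1) \<rho>, of "int e"] e by simp
    moreover have "r \<noteq> \<one>" using rd False by auto
    moreover have "r [^] ?d = a \<otimes> \<one> [^] e" using rd ac by simp
    ultimately show ?thesis using subgroup.one_closed[OF summand_subgroup[OF \<rho>]] by blast
  qed
qed

lemma ex_basis_description:
  assumes a: "a \<in> Pi T F" and desc: "described_by G R e (\<Otimes>\<rho>\<in>T. a \<rho>)"
  shows "\<exists>v. (\<forall>\<rho>\<in>T. v \<rho> \<in> F \<rho> - {\<one>}) \<and>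
    described_by G R e (\<Otimes>\<rho>\<in>T. v \<rho> [^] gcd_in G R e (a \<rho>))"
proof -
  have e: "0 < e" using desc unfolding described_by_iff by blast
  have "\<exists>v s. v \<in> F \<rho> - {\<one>} \<and> s \<in> F \<rho> \<and> v [^] gcd_in G R e (a \<rho>) = a \<rho> \<otimes> s [^] e"
    if "\<rho> \<in> T" for \<rho>
    using ex_gcd_root[OF that _ e] a that by blast
  then obtain v s where root: "\<And>\<rho>. \<rho> \<in> T \<Longrightarrow>
      v \<rho> \<in> F \<rho> - {\<one>} \<and> s \<rho> \<in> F \<rho> \<and> v \<rho> [^] gcd_in G R e (a \<rho>) = a \<rho> \<otimes> s \<rho> [^] e"
    by metis
  have s: "s \<in> Pi T F" using root by blast
  note ac = family_carrier[OF subset_refl a] and sc = family_carrier[OF subset_refl s]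
  have "(\<Otimes>\<rho>\<in>T. v \<rho> [^] gcd_in G R e (a \<rho>)) = (\<Otimes>\<rho>\<in>T. a \<rho> \<otimes> s \<rho> [^] e)"
    using root ac sc by (intro finprod_cong') (auto simp: Pi_iff)
  also have "\<dots> = (\<Otimes>\<rho>\<in>T. a \<rho>) \<otimes> (\<Otimes>\<rho>\<in>T. s \<rho> [^] e)"
    using ac sc by (intro finprod_multf) (auto simp: Pi_iff)
  also have "(\<Otimes>\<rho>\<in>T. s \<rho> [^] e) = (\<Otimes>\<rho>\<in>T. s \<rho>) [^] e"
    using finprod_int_pow[OF sc, of "int e"] by (simp add: int_pow_int)
  finally have "described_by G R e (\<Otimes>\<rho>\<in>T. v \<rho> [^] gcd_in G R e (a \<rho>))"
    using described_by_mult_pow[OF sum_subgroup desc finprod_in[OF s]] by simp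
  then show ?thesis using root by blast
qed

lemma card_eq_two_if_rank_two:
  assumes "rk G (carrier G) = 2" shows "card T = 2"
proof -
  have rk: "rk G R = 2"
    using assms rk_purification[OF sum_subgroup] carrier_eq_purification by simp
  have "F \<rho> \<noteq> {\<one>}" if "\<rho> \<in> T" for \<rho> using summand_nontrivial[OF that] by blast
  then have "card T \<le> 2" using card_index_le_rk rk by simp
  moreover have "card T \<noteq> 0"
  proof
    assume "card T = 0"
    then have "T = {}" using finite_index by simp
    then have "y = \<one>" if "y \<in> R" for y using finprod_component[OF that] by simp
    then have "R = {\<one>}" using one_in by blast
    then show False using rk rk_trivial by simp
  qed
  moreover have "card T \<noteq> 1"
  proof
    assume "card T = 1"
    then obtain \<rho> where T: "T = {\<rho>}" by (rule card_1_singletonE)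
    then have "y \<in> F \<rho>" if "y \<in> R" for y using in_summandI[OF that, of \<rho>] by simp
    then have "R = F \<rho>" using summand_in T by blast
    then show False using rk rank_one T by simp
  qed
  ultimately show ?thesis by linarith
qed

lemma rank_two_description:
  assumes rk: "rk G (carrier G) = 2" and v: "\<And>\<rho>. \<rho> \<in> T \<Longrightarrow> v \<rho> \<in> F \<rho> - {\<one>}"
    and desc: "described_by G R e (\<Otimes>\<rho>\<in>T. v \<rho> [^] \<alpha> \<rho>)" and \<alpha>: "\<And>\<rho>. \<rho> \<in> T \<Longrightarrow> \<alpha> \<rho> dvd e"
    and gcd: "\<And>\<tau>. \<tau> \<in> T \<Longrightarrow> gcd_in G R e (\<Otimes>\<rho>\<in>T - {\<tau>}. v \<rho> [^] (\<alpha> \<rho> :: nat)) = 1"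
  shows "\<exists>v\<^sub>1 v\<^sub>2. v\<^sub>1 \<noteq> v\<^sub>2 \<and> decomposition_basis G R {v\<^sub>1, v\<^sub>2} \<and> described_by G R e (v\<^sub>1 \<otimes> v\<^sub>2) \<and>
    gcd_in G R e v\<^sub>1 = 1 \<and> gcd_in G R e v\<^sub>2 = 1"
proof -
  obtain \<sigma> \<tau> where T: "T = {\<sigma>, \<tau>}" "\<sigma> \<noteq> \<tau>"
    using card_eq_two_if_rank_two[OF rk] by (auto simp: card_2_iff)
  have vc: "v \<rho> \<in> carrier G" "v \<rho> \<in> R" if "\<rho> \<in> T" for \<rho>
    using v[OF that] summand_in[OF that] in_carrier by auto
  have unit: "\<alpha> \<rho> = 1 \<and> gcd_in G R e (v \<rho>) = 1"
    if \<rho>: "\<rho> \<in> T" and "gcd_in G R e (v \<rho> [^] \<alpha> \<rho>) = 1" for \<rho>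
  proof -
    have "0 < e" using desc unfolding described_by_iff by blast
    then have "\<alpha> \<rho> = 1"
      using dvd_gcd_in_nat_pow[OF sum_subgroup vc(2)[OF \<rho>] \<alpha>[OF \<rho>]] that(2) by simp
    then show ?thesis using that(2) vc(1)[OF \<rho>] by simp
  qed
  have "T - {\<tau>} = {\<sigma>}" "T - {\<sigma>} = {\<tau>}" using T by auto
  then have "\<alpha> \<sigma> = 1 \<and> gcd_in G R e (v \<sigma>) = 1" "\<alpha> \<tau> = 1 \<and> gcd_in G R e (v \<tau>) = 1"
    using unit[of \<sigma>] unit[of \<tau>] gcd[of \<tau>] gcd[of \<sigma>] vc(1) T(1) by auto
  moreover from this have "described_by G R e (v \<sigma> \<otimes> v \<tau>)" using desc T vc(1) by simp
  moreover have "decomposition_basis G R {v \<sigma>, v \<tau>}"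
    using decomposition_basis_family[OF v] T(1) by simp
  moreover have "v \<sigma> \<noteq> v \<tau>" using inj_on_nontrivial_family[OF v] T by (auto simp: inj_on_def)
  ultimately show ?thesis by blast
qed

end

section \<open>Rigid almost completely decomposable groups\<close>

context tffr
begin

lemma rigid_decompositionI:
  assumes "almost_completely_decomposable G" "rigid G"
    and F: "homogeneous_decomposition G (regulator G) (Tcr G) F"
  shows "rigid_decomposition G (regulator G) (Tcr G) F"
proof unfold_locales
  show "direct_decomp G (regulator G) (Tcr G) F"
    using F unfolding homogeneous_decomposition_def by blast
  show rk1: "rk G (F \<rho>) = 1" if "\<rho> \<in> Tcr G" for \<rho>
    using assms(2) F that unfolding rigid_def by blast
  show "type_of G (F \<rho>) = \<rho>" if "\<rho> \<in> Tcr G" for \<rho>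
    using F that homogeneous_rank_one rk1 unfolding homogeneous_decomposition_def by blast
  show "\<sigma> = \<tau>" if "\<sigma> \<in> Tcr G" "\<tau> \<in> Tcr G" "type_le \<sigma> \<tau>" for \<sigma> \<tau>
    using assms(2) that unfolding rigid_def block_rigid_def by blast
qed (rule regulator_exponent[OF assms(1)])

lemma mu_eq_ord_mod:
  assumes acd: "almost_completely_decomposable G" and rigid: "rigid G"
    and F: "homogeneous_decomposition G (regulator G) (Tcr G) F"
    and a: "a \<in> Pi (Tcr G) F" and desc: "described_by G (regulator G) e (\<Otimes>\<rho>\<in>Tcr G. a \<rho>)"
    and \<tau>: "\<tau> \<in> Tcr G"
  shows "mu G \<tau> = ord_mod G (regulator G) e (a \<tau>)"
proof -
  interpret F: rigid_decomposition G "regulator G" "Tcr G" F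
    by (rule rigid_decompositionI[OF acd rigid F])
  have exponent: "\<forall>x\<in>carrier G. x [^] e \<in> regulator G"
    using described_by_nat_pow_in[OF F.sum_subgroup desc F.finprod_in[OF a]] by blast
  show ?thesis
    unfolding mu_def
  proof (rule the_equality, goal_cases)
    case 1
    show ?case using F exponent a desc \<tau> by (intro exI[of _ e] exI[of _ F] exI[of _ a]) simp
  next
    case (2 m)
    then obtain e' F' a' where F': "homogeneous_decomposition G (regulator G) (Tcr G) F'"
      and a': "a' \<in> Pi (Tcr G) F'"
      and desc': "described_by G (regulator G) e' (\<Otimes>\<rho>\<in>Tcr G. a' \<rho>)"
      and m: "m = ord_mod G (regulator G) e' (a' \<tau>)"
      using \<tau> by auto
    have "a' \<in> Pi (Tcr G) F"
      using a' F.decomposition_unique[OF rigid_decompositionI[OF acd rigid F']] by auto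
    then show ?case unfolding m using F.ord_mod_component[OF \<tau>] a desc desc' by metis
  qed
qed

lemma mu_eq_div_gcd_in:
  assumes acd: "almost_completely_decomposable G" and rigid: "rigid G"
    and F: "homogeneous_decomposition G (regulator G) (Tcr G) F"
    and a: "a \<in> Pi (Tcr G) F" "described_by G (regulator G) e (\<Otimes>\<rho>\<in>Tcr G. a \<rho>)"
    and \<tau>: "\<tau> \<in> Tcr G"
  shows "mu G \<tau> = e div gcd_in G (regulator G) e (a \<tau>)"
proof -
  interpret F: rigid_decomposition G "regulator G" "Tcr G" F
    by (rule rigid_decompositionI[OF acd rigid F])
  have "a \<tau> \<in> regulator G" using a(1) F.summand_in \<tau> by blast
  then have "e = gcd_in G (regulator G) e (a \<tau>) * mu G \<tau>"
    unfolding mu_eq_ord_mod[OF acd rigid F a \<tau>]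
    by (rule gcd_in_mult_ord_mod[OF F.sum_subgroup, symmetric])
  moreover have "0 < e" using a(2) unfolding described_by_iff by blast
  ultimately show ?thesis by (metis mult_is_0 nat_less_le nonzero_mult_div_cancel_left)
qed

end

theorem lemma5p12:
  fixes X :: "('a, 'b) monoid_scheme" (structure)
    and R :: "'a set" and Rc :: "rtype \<Rightarrow> 'a set"
  assumes B: "B_group X" and rigid: "rigid X"
    and R: "R = regulator X"
    and Rc: "homogeneous_decomposition X R (Tcr X) Rc"
  shows
    "(\<exists>(e::nat) (\<alpha> :: rtype \<Rightarrow> nat) (v :: rtype \<Rightarrow> 'a).
        described_by X R e (\<Otimes>\<rho>\<in>Tcr X. v \<rho> [^] \<alpha> \<rho>) \<and>
        \<comment> \<open>(1)\<close>
        decomposition_basis X R (v ` Tcr X) \<and>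
        direct_decomp X R (Tcr X) (\<lambda>\<rho>. rat_multiples X (coeff_group X R (v \<rho>)) (v \<rho>)) \<and>
        (\<forall>\<rho>\<in>Tcr X. coeff_group X R (v \<rho>) \<in> \<rho> \<and>
            rat_multiples X (coeff_group X R (v \<rho>)) (v \<rho>) = Rc \<rho>) \<and>
        \<comment> \<open>(2)\<close>
        (\<forall>\<tau>\<in>Tcr X. gcd_in X R e (\<Otimes>\<rho>\<in>Tcr X - {\<tau>}. v \<rho> [^] \<alpha> \<rho>) = 1) \<and>
        \<comment> \<open>(3)\<close>
        e = card (rcosets R) \<and>
        \<comment> \<open>(4)\<close>
        (\<forall>\<rho>\<in>Tcr X. \<alpha> \<rho> dvd e) \<and>
        \<comment> \<open>(5)\<close>
        (\<forall>\<tau>\<in>Tcr X. mu X \<tau> = e div \<alpha> \<tau>))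
     \<and> (\<forall>e::nat. rk X (carrier X) = 2 \<and> card (rcosets R) = e \<longrightarrow>
        (\<exists>v\<^sub>1 v\<^sub>2. v\<^sub>1 \<noteq> v\<^sub>2 \<and> decomposition_basis X R {v\<^sub>1, v\<^sub>2} \<and>
           described_by X R e (v\<^sub>1 \<otimes> v\<^sub>2) \<and>
           gcd_in X R e v\<^sub>1 = 1 \<and> gcd_in X R e v\<^sub>2 = 1))"
proof -
  let ?T = "Tcr X" and ?e = "card (rcosets R)"
  have acd: "almost_completely_decomposable X" and cyclic: "cyclic_group (X Mod R)"
    using B R unfolding B_group_def by auto
  interpret tffr X by (rule almost_completely_decomposable_imp_tffr[OF acd])
  interpret rigid_decomposition X R ?T Rc
    using rigid_decompositionI[OF acd rigid] Rc unfolding R .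
  obtain a where a: "a \<in> Pi ?T Rc" "described_by X R ?e (\<Otimes>\<rho>\<in>?T. a \<rho>)"
    using ex_description[OF cyclic] by blast
  define \<alpha> where "\<alpha> \<rho> = gcd_in X R ?e (a \<rho>)" for \<rho>
  obtain v where v: "\<And>\<rho>. \<rho> \<in> ?T \<Longrightarrow> v \<rho> \<in> Rc \<rho> - {\<one>}"
    and desc: "described_by X R ?e (\<Otimes>\<rho>\<in>?T. v \<rho> [^] \<alpha> \<rho>)"
    using ex_basis_description[OF a] unfolding \<alpha>_def by blast
  have mu: "mu X \<rho> = ?e div \<alpha> \<rho>" if "\<rho> \<in> ?T" for \<rho>
    using mu_eq_div_gcd_in[OF acd rigid] Rc a that unfolding \<alpha>_def R by blast
  have dvd: "\<alpha> \<rho> dvd ?e" if "\<rho> \<in> ?T" for \<rho>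
    using gcd_in_dvd[OF sum_subgroup] summand_in[OF that] a(1) that unfolding \<alpha>_def by blast
  have "(\<lambda>\<rho>. v \<rho> [^] \<alpha> \<rho>) \<in> Pi ?T Rc"
    using v subgroup_nat_pow_closed[OF summand_subgroup] by blast
  then have gcd: "gcd_in X R ?e (\<Otimes>\<rho>\<in>?T - {\<tau>}. v \<rho> [^] \<alpha> \<rho>) = 1" if "\<tau> \<in> ?T" for \<tau>
    using gcd_in_omit_component[OF that regulator_summand_pure[OF R that] _ refl desc] by blast
  have "coeff_group X R (v \<rho>) \<in> \<rho> \<and> rat_multiples X (coeff_group X R (v \<rho>)) (v \<rho>) = Rc \<rho>"
    if "\<rho> \<in> ?T" for \<rho> using coeff_group_in[OF that] rat_multiples_eq[OF that] v[OF that] by blast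
  then show ?thesis
    using desc decomposition_basis_family[OF v] direct_decomp_rat_multiples[OF v] gcd dvd mu
      rank_two_description[OF _ v desc dvd gcd] by blast
qed

end
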